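(* Let $0\le r\le n$. For $\lambda\in\mathrm{Part}_{r,n}$, let $D_\lambda$ be the set of boxes of $\lambda$ corresponding to $\mathrm{Inv}^Q(A)$, where $\lambda=\lambda_A$. The $T$-orbits in $\mathrm{QGr}(r;n)$ are the sets $O_{\lambda,S}$, for $\lambda\in\mathrm{Part}_{r,n}$ and $S\subseteq D_\lambda$, consisting of the points of $\mathring X^\lambda_{\mathrm{NC}}$ whose coordinates indexed by $S$ are all nonzero and whose coordinates indexed by $D_\lambda\setminus S$ are all zero. Each such $S\subseteq\lambda$ is a noncrossing Le diagram, and the closure of $O_{\lambda,S}$ in $\mathrm{Gr}(r;n)$ is the positroid variety with Le diagram $S\subseteq\lambda$.
   Context: $T=(\mathbb C^* )^n$ acts on $\mathrm{Gr}(r;n)$ (the $r$-planes in $\mathbb C^n$) by scaling coordinates. $[n]=\{1,\dots,n\}$. **Partitions and boxes.** $\mathrm{Part}_{r,n}$ is the set of partitions inside an $r\times(n-r)$ rectangle (English notation). For $A=\{a_1<\cdots<a_r\}\in\binom{[n]}{r}$, $\lambda_A=(a_r-r,\dots,a_1-1)$, giving a bijection $\binom{[n]}r\to\mathrm{Part}_{r,n}$. $\mathrm{Inv}(A)=\{(i,j)\mid i<j,\ j\in A,\ i\notin A\}$. Label the steps of the boundary path of $\lambda_A$ in the rectangle from bottom left to top right by $1,\dots,n$; the north steps are those labeled by $A$. The pair $(i,j)\in\mathrm{Inv}(A)$ corresponds to the box in the row of north step $j$ and the column of east step $i$; this is a bijection from $\mathrm{Inv}(A)$ to the boxes of $\lambda_A$.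 **Noncrossing partitions and $\mathrm{Inv}^Q$.** $\mathrm{NC}_n\subset S_n$ is the set of permutations obtained from noncrossing set partitions of $[n]$ by turning each block $\{b_1<\cdots<b_s\}$ into the cycle $(b_s\,b_{s-1}\cdots b_1)$ and multiplying. $u,w\in\mathrm{NC}_n$ are Kreweras-adjacent if $w=\tau u$ for a transposition $\tau$. $QJ_{r,n}$ is the graph on $\binom{[n]}r$ with edges $AB$, $B=(A\setminus j)\cup i$ ($j\in A$, $i\notin A$), such that $A=w\cdot[r]$, $B=u\cdot[r]$ for some Kreweras-adjacent $w,u\in\mathrm{NC}_n$. $\mathrm{Inv}^Q(A)=\{(i,j)\in\mathrm{Inv}(A)\mid AB\in E(QJ_{r,n}),\ B=(A\setminus j)\cup i\}$. **Cells and $\mathrm{QGr}$.** $\mathring X^{\lambda_A}$ is the set of column spans of $n\times r$ matrices $M$ with $M_{a_j,j}=1$, $M_{i,j}$ arbitrary for $(i,a_j)\in\mathrm{Inv}(A)$ (these are the coordinates, indexed by boxes of $\lambda_A$), other entries $0$. $\mathring X^{\lambda_A}_{\mathrm{NC}}\subset\mathring X^{\lambda_A}$ is the subspace where coordinates outside $\mathrm{Inv}^Q(A)$ vanish. The quasisymmetric Grassmannian is $\mathrm{QGr}(r;n)=\pi(\mathrm{QFl}_n)$, with $\pi:\mathrm{Fl}_n\to\mathrm{Gr}(r;n)$, $V_\bullet\mapsto V_r$, and $\mathrm{QFl}_n=\bigsqcup_{w\in\mathrm{NC}_n}\mathring X^w_{\mathrm{NC}}$, where $\mathring X^w_{\mathrm{NC}}$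 is the set of flags ($V_i$ = span of first $i$ columns) of matrices with $1$ in positions $(w(j),j)$, arbitrary entries in positions $(i,w^{-1}(j))$ for those $i<j$ with $w^{-1}(i)>w^{-1}(j)$ and $(i\,j)w\in\mathrm{NC}_n$, and $0$ elsewhere. **Le diagrams and positroid varieties.** $L\subseteq\lambda$ is a noncrossing Le diagram if (1) any box of $\lambda$ strictly below a box of $L$ in its column and strictly right of a box of $L$ in its row is in $L$; (2) for each $b\in L$, either no box of $L$ is strictly above $b$ in its column, or no box of $L$ is strictly left of $b$ in its row. Condition (1) alone defines a Le diagram. The $\Gamma$-network of a Le diagram $L\subseteq\lambda_A$ is the directed graph on $[n]\cup L$ with: in the row of each north step $j$, edges from $j$ to the rightmost box of $L$ in the row and from each box of $L$ to the next box of $L$ to its left; in the column of each east step $i$, edges from each box of $L$ to the next box of $L$ below it, and from the lowest box of $L$ to $i$. The positroid variety with Le diagram $L$ is the closure in $\mathrm{Gr}(r;n)$ of the set of points of $\mathring X^{\lambda_A}$ parametrized by $c\in(\mathbb C^* )^L$ via $\Delta_{(A\setminus j)\cup i}/\Delta_A=\sum_{P:j\to i}\prod_b c_b$ for all $(i,j)\in\mathrm{Inv}(A)$, the sum over directed walks $P$ from $j$ to $i$ in the network and the product over boxes $b$ entered by $P$ along a horizontal edge. Here $\Delta_A=\det(M_{i,j})_{i\in A,j\in[r]}$ are Plücker coordinates. *)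

theory Defs
  imports
    "HOL-Analysis.Function_Topology"
    "HOL-Analysis.Abstract_Topology"
    "HOL-Combinatorics.Cycles"
    "HOL-Library.Disjoint_Sets"
    "HOL-Library.Function_Algebras"
    "Jordan_Normal_Form.Determinant"
begin

section \<open>Subsets, partitions and boxes\<close>

definition subsets :: "nat \<Rightarrow> nat \<Rightarrow> nat set set" where
  "subsets r n = {A. A \<subseteq> {1..n} \<and> card A = r}"

text \<open>A partition inside the \<open>r \<times> (n - r)\<close> rectangle is a weakly decreasing list of exactly \<open>r\<close>
  parts, trailing zeros included. A box is a pair (row, column), both counted from 1, with row 1
  at the top and column 1 at the left.\<close>

definition Part :: "nat \<Rightarrow> nat \<Rightarrow> nat list set" where
  "Part r n = {la. length la = r \<and> sorted_wrt (\<ge>) la \<and> set la \<subseteq> {..n - r}}"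

definition boxes :: "nat list \<Rightarrow> (nat \<times> nat) set" where
  "boxes la = {(p, q). 1 \<le> p \<and> p \<le> length la \<and> 1 \<le> q \<and> q \<le> la ! (p - 1)}"

text \<open>For \<open>A = {a\<^sub>1 < \<dots> < a\<^sub>r}\<close> this is \<open>(a\<^sub>r - r, \<dots>, a\<^sub>1 - 1)\<close>.\<close>

definition partition_of :: "nat set \<Rightarrow> nat list" where
  "partition_of A = rev (map (\<lambda>k. sorted_list_of_set A ! k - Suc k) [0..<card A])"

definition subset_of :: "nat \<Rightarrow> nat \<Rightarrow> nat list \<Rightarrow> nat set" where
  "subset_of r n = the_inv_into (subsets r n) partition_of"

lemma sorted_list_gap:
  assumes "A \<subseteq> {1..n}" "k < card A"
  shows "sorted_list_of_set A ! k \<ge> Suc k" "sorted_list_of_set A ! k + card A \<le> n + Suc k"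
proof -
  have fin: "finite A" using assms(1) finite_subset by blast
  let ?s = "sorted_list_of_set A"
  have len: "length ?s = card A" by simp
  have lt: "\<And>i j. i < j \<Longrightarrow> j < card A \<Longrightarrow> ?s ! i < ?s ! j"
    using strict_sorted_list_of_set[of A] len sorted_wrt_nth_less by metis
  have mem: "\<And>i. i < card A \<Longrightarrow> ?s ! i \<in> {1..n}"
    using assms(1) fin len by (metis nth_mem set_sorted_list_of_set subsetD)
  show "?s ! k \<ge> Suc k" using assms(2)
  proof (induction k)
    case 0 then show ?case using mem[of 0] by simp
  next
    case (Suc k) then show ?case using lt[of k "Suc k"] by simp
  qed
  have "?s ! (card A - Suc d) + Suc d \<le> Suc n" if "d < card A" for d using that
  proof (induction d)
    case 0 then show ?case using mem[of "card A - 1"] by simp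
  next
    case (Suc d)
    then have "?s ! (card A - Suc (Suc d)) < ?s ! (card A - Suc d)" by (intro lt) auto
    with Suc show ?case by simp
  qed
  from this[of "card A - Suc k"] show "?s ! k + card A \<le> n + Suc k"
    using assms(2) by simp
qed

lemma bij_partition_of:
  assumes "r \<le> n"
  shows "bij_betw partition_of (subsets r n) (Part r n)"
  unfolding bij_betw_def
proof
  show "inj_on partition_of (subsets r n)"
  proof (rule inj_onI)
    fix A B assume A: "A \<in> subsets r n" and B: "B \<in> subsets r n"
      and eq: "partition_of A = partition_of B"
    have c: "card A = r" "card B = r" "A \<subseteq> {1..n}" "B \<subseteq> {1..n}"
      using A B by (auto simp: subsets_def)
    have fin: "finite A" "finite B" using c finite_subset by blast+
    have "map (\<lambda>k. sorted_list_of_set A ! k - Suc k) [0..<r]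
        = map (\<lambda>k. sorted_list_of_set B ! k - Suc k) [0..<r]"
      using eq c by (simp add: partition_of_def)
    then have e: "sorted_list_of_set A ! k - Suc k = sorted_list_of_set B ! k - Suc k" if "k < r" for k
      using that by (auto simp: map_eq_conv)
    have "sorted_list_of_set A = sorted_list_of_set B"
    proof (rule nth_equalityI)
      fix k assume "k < length (sorted_list_of_set A)"
      then have k: "k < r" using c by simp
      show "sorted_list_of_set A ! k = sorted_list_of_set B ! k"
        using e[OF k] sorted_list_gap(1)[of A n k] sorted_list_gap(1)[of B n k] c k by simp
    qed (use c in simp)
    then show "A = B" using fin by (metis set_sorted_list_of_set)
  qed
  show "partition_of ` subsets r n = Part r n"
  proof (intro equalityI subsetI)
    fix la assume "la \<in> partition_of ` subsets r n"
    then obtain A where A: "A \<subseteq> {1..n}" "card A = r" and la: "la = partition_of A"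
      by (auto simp: subsets_def)
    let ?f = "\<lambda>k. sorted_list_of_set A ! k - Suc k"
    have mono: "?f i \<le> ?f j" if "i < j" "j < r" for i j
      using that
    proof (induction j)
      case (Suc j)
      have "sorted_list_of_set A ! j < sorted_list_of_set A ! Suc j"
        using strict_sorted_list_of_set[of A] Suc.prems(2) A(2)
        by (metis lessI length_sorted_list_of_set sorted_wrt_nth_less)
      then have "?f j \<le> ?f (Suc j)" by simp
      then show ?case using Suc by (cases "i = j") auto
    qed simp
    have "sorted_wrt (\<le>) (map ?f [0..<r])"
      unfolding sorted_wrt_iff_nth_less using mono by simp
    then have "sorted_wrt (\<ge>) la" using la A by (simp add: partition_of_def sorted_wrt_rev)
    moreover have "?f k \<le> n - r" if "k < r" for k
      using sorted_list_gap(2)[of A n k] A that assms by simp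
    ultimately show "la \<in> Part r n" using la A by (auto simp: Part_def partition_of_def)
  next
    fix la assume "la \<in> Part r n"
    then have len: "length la = r" and dec: "sorted_wrt (\<ge>) la" and bd: "set la \<subseteq> {..n - r}"
      by (auto simp: Part_def)
    define xs where "xs = map (\<lambda>k. rev la ! k + Suc k) [0..<r]"
    have "sorted_wrt (\<le>) (rev la)" using dec by (simp add: sorted_wrt_rev)
    then have inc: "\<And>i j. i < j \<Longrightarrow> j < r \<Longrightarrow> rev la ! i \<le> rev la ! j"
      using len by (simp add: sorted_wrt_iff_nth_less)
    have ss: "sorted_wrt (<) xs"
      unfolding sorted_wrt_iff_nth_less xs_def using inc by (auto simp: add_le_less_mono)
    have lx: "length xs = r" by (simp add: xs_def)
    have sl: "sorted_list_of_set (set xs) = xs"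
      using ss by (metis sorted_list_of_set.idem_if_sorted_distinct strict_sorted_iff)
    have card: "card (set xs) = r"
      using ss lx by (metis distinct_card strict_sorted_iff)
    have "rev la ! k \<le> n - r" if "k < r" for k
      using bd that len by (metis atMost_iff length_rev nth_mem set_rev subsetD)
    then have "rev la ! k + Suc k \<in> {1..n}" if "k < r" for k
    proof -
      have "rev la ! k \<le> n - r" using that \<open>\<And>k. k < r \<Longrightarrow> rev la ! k \<le> n - r\<close> by blast
      then show ?thesis using that assms by simp
    qed
    then have "set xs \<subseteq> {1..n}" unfolding xs_def by auto
    then have "set xs \<in> subsets r n" using card by (simp add: subsets_def)
    moreover have "partition_of (set xs) = la"
    proof -
      have "map (\<lambda>k. xs ! k - Suc k) [0..<r] = rev la"
        by (rule nth_equalityI) (auto simp: xs_def len)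
      then show ?thesis by (simp add: partition_of_def sl card)
    qed
    ultimately show "la \<in> partition_of ` subsets r n" by force
  qed
qed

definition Inv :: "nat \<Rightarrow> nat set \<Rightarrow> (nat \<times> nat) set" where
  "Inv n A = {(i, j). i \<in> {1..n} \<and> i \<notin> A \<and> j \<in> A \<and> i < j}"

text \<open>The boundary path runs from bottom left to top right, so the rows met by the north steps are
  counted downwards from the largest element of \<open>A\<close>, and the columns met by the east steps from
  left to right.\<close>

definition row_of :: "nat set \<Rightarrow> nat \<Rightarrow> nat" where
  "row_of A j = card {a \<in> A. j \<le> a}"

definition col_of :: "nat \<Rightarrow> nat set \<Rightarrow> nat \<Rightarrow> nat" where
  "col_of n A i = card {e \<in> {1..n} - A. e \<le> i}"

definition box_of :: "nat \<Rightarrow> nat set \<Rightarrow> nat \<times> nat \<Rightarrow> nat \<times> nat" where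
  "box_of n A = (\<lambda>(i, j). (row_of A j, col_of n A i))"


section \<open>Noncrossing partitions\<close>

definition noncrossing :: "nat set set \<Rightarrow> bool" where
  "noncrossing P \<longleftrightarrow>
    (\<forall>X\<in>P. \<forall>Y\<in>P. \<forall>a\<in>X. \<forall>b\<in>Y. \<forall>c\<in>X. \<forall>d\<in>Y. a < b \<and> b < c \<and> c < d \<longrightarrow> X = Y)"

definition block_cycle :: "nat set \<Rightarrow> nat \<Rightarrow> nat" where
  "block_cycle X = cycle_of_list (rev (sorted_list_of_set X))"

text \<open>The list only orders the blocks; the product does not depend on it, as disjoint cycles
  commute.\<close>

definition NC :: "nat \<Rightarrow> (nat \<Rightarrow> nat) set" where
  "NC n = {foldr (\<circ>) (map block_cycle Xs) id | Xs.
     distinct Xs \<and> partition_on {1..n} (set Xs) \<and> noncrossing (set Xs)}"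

definition kreweras_adjacent :: "nat \<Rightarrow> (nat \<Rightarrow> nat) \<Rightarrow> (nat \<Rightarrow> nat) \<Rightarrow> bool" where
  "kreweras_adjacent n w u \<longleftrightarrow> w \<in> NC n \<and> u \<in> NC n \<and>
     (\<exists>a b. a \<noteq> b \<and> w = Transposition.transpose a b \<circ> u)"

definition QJ_edge :: "nat \<Rightarrow> nat \<Rightarrow> nat set \<Rightarrow> nat set \<Rightarrow> bool" where
  "QJ_edge r n A B \<longleftrightarrow> A \<in> subsets r n \<and> B \<in> subsets r n \<and>
     (\<exists>j\<in>A. \<exists>i\<in>{1..n} - A. B = insert i (A - {j})) \<and>
     (\<exists>w u. kreweras_adjacent n w u \<and> A = w ` {1..r} \<and> B = u ` {1..r})"

definition InvQ :: "nat \<Rightarrow> nat \<Rightarrow> nat set \<Rightarrow> (nat \<times> nat) set" where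
  "InvQ r n A = {(i, j) \<in> Inv n A. QJ_edge r n A (insert i (A - {j}))}"

definition D :: "nat \<Rightarrow> nat \<Rightarrow> nat list \<Rightarrow> (nat \<times> nat) set" where
  "D r n la = box_of n (subset_of r n la) ` InvQ r n (subset_of r n la)"


section \<open>The Grassmannian and the torus action\<close>

text \<open>Vectors of \<open>\<complex>\<^sup>n\<close> are functions \<open>nat \<Rightarrow> complex\<close> that vanish outside \<open>{1..n}\<close>, and
  \<open>n \<times> r\<close> matrices are functions of the row and the column index that vanish outside
  \<open>{1..n} \<times> {1..r}\<close>.\<close>

definition vscale :: "complex \<Rightarrow> (nat \<Rightarrow> complex) \<Rightarrow> nat \<Rightarrow> complex" where
  "vscale c v = (\<lambda>i. c * v i)"

global_interpretation cvs: vector_space vscale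
  by unfold_locales (simp_all add: vscale_def fun_eq_iff distrib_left distrib_right mult.assoc)

definition cspace :: "nat \<Rightarrow> (nat \<Rightarrow> complex) set" where
  "cspace n = {v. \<forall>i. i \<notin> {1..n} \<longrightarrow> v i = 0}"

definition Gr :: "nat \<Rightarrow> nat \<Rightarrow> (nat \<Rightarrow> complex) set set" where
  "Gr r n = {V. cvs.subspace V \<and> V \<subseteq> cspace n \<and> cvs.dim V = r}"

definition mats :: "nat \<Rightarrow> nat \<Rightarrow> (nat \<Rightarrow> nat \<Rightarrow> complex) set" where
  "mats n r = {M. \<forall>i j. (i, j) \<notin> {1..n} \<times> {1..r} \<longrightarrow> M i j = 0}"

definition colspan :: "nat \<Rightarrow> (nat \<Rightarrow> nat \<Rightarrow> complex) \<Rightarrow> (nat \<Rightarrow> complex) set" where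
  "colspan k M = cvs.span ((\<lambda>j i. M i j) ` {1..k})"

text \<open>The classical topology of the Grassmannian: the quotient of the space of \<open>n \<times> r\<close> matrices
  of rank \<open>r\<close> (with the Euclidean topology) by the map sending a matrix to its column span.
  On constructible sets, such as all the sets whose closures are taken below, the closure in this
  topology is also the Zariski closure.\<close>

definition full_rank_mats :: "nat \<Rightarrow> nat \<Rightarrow> (nat \<Rightarrow> nat \<Rightarrow> complex) set" where
  "full_rank_mats n r = {M \<in> mats n r. colspan r M \<in> Gr r n}"

definition Gr_topology :: "nat \<Rightarrow> nat \<Rightarrow> (nat \<Rightarrow> complex) set topology" where
  "Gr_topology r n = topology (\<lambda>U. U \<subseteq> Gr r n \<and>
     openin (top_of_set (full_rank_mats n r)) {M \<in> full_rank_mats n r. colspan r M \<in> U})"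

lemma openin_Gr_topology:
  "openin (Gr_topology r n) U \<longleftrightarrow> U \<subseteq> Gr r n \<and>
     openin (top_of_set (full_rank_mats n r)) {M \<in> full_rank_mats n r. colspan r M \<in> U}"
proof -
  let ?X = "top_of_set (full_rank_mats n r)"
  let ?pre = "\<lambda>U. {M \<in> full_rank_mats n r. colspan r M \<in> U}"
  have "istopology (\<lambda>U. U \<subseteq> Gr r n \<and> openin ?X (?pre U))"
    unfolding istopology_def
  proof (intro conjI allI impI)
    fix S T assume S: "S \<subseteq> Gr r n \<and> openin ?X (?pre S)" and T: "T \<subseteq> Gr r n \<and> openin ?X (?pre T)"
    have eq: "?pre (S \<inter> T) = ?pre S \<inter> ?pre T" by blast
    show "openin ?X (?pre (S \<inter> T))"
      unfolding eq using S T by (blast intro: openin_Int)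
    show "S \<inter> T \<subseteq> Gr r n" using S by blast
  next
    fix K assume K: "\<forall>U\<in>K. U \<subseteq> Gr r n \<and> openin ?X (?pre U)"
    have eq: "?pre (\<Union>K) = \<Union>(?pre ` K)" by blast
    show "openin ?X (?pre (\<Union>K))"
      unfolding eq using K by (blast intro: openin_Union)
    show "\<Union>K \<subseteq> Gr r n" using K by blast
  qed
  then show ?thesis unfolding Gr_topology_def by (rule fun_cong[OF topology_inverse'])
qed

definition Gr_closure :: "nat \<Rightarrow> nat \<Rightarrow> (nat \<Rightarrow> complex) set set \<Rightarrow> (nat \<Rightarrow> complex) set set" where
  "Gr_closure r n X = Abstract_Topology.closure_of (Gr_topology r n) X"

definition torus :: "nat \<Rightarrow> (nat \<Rightarrow> complex) set" where
  "torus n = {1..n} \<rightarrow>\<^sub>E (UNIV - {0})"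

definition torus_act ::
  "(nat \<Rightarrow> complex) \<Rightarrow> (nat \<Rightarrow> complex) set \<Rightarrow> (nat \<Rightarrow> complex) set" where
  "torus_act t V = (\<lambda>v i. t i * v i) ` V"

definition torus_orbit :: "nat \<Rightarrow> (nat \<Rightarrow> complex) set \<Rightarrow> (nat \<Rightarrow> complex) set set" where
  "torus_orbit n V = {torus_act t V | t. t \<in> torus n}"


section \<open>Cells and the quasisymmetric Grassmannian\<close>

text \<open>If \<open>j = a\<^sub>k\<close> then \<open>pos A j = k\<close>, so \<open>M i (pos A j)\<close> is the coordinate at the box of \<open>(i, j)\<close>.\<close>

definition pos :: "nat set \<Rightarrow> nat \<Rightarrow> nat" where
  "pos A j = card {a \<in> A. a \<le> j}"

definition cell_mats :: "nat \<Rightarrow> nat set \<Rightarrow> (nat \<Rightarrow> nat \<Rightarrow> complex) set" where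
  "cell_mats n A = {M \<in> mats n (card A). \<forall>j\<in>A. M j (pos A j) = 1 \<and>
     (\<forall>i\<in>{1..n}. i \<noteq> j \<and> (i, j) \<notin> Inv n A \<longrightarrow> M i (pos A j) = 0)}"

definition NC_cell_mats :: "nat \<Rightarrow> nat \<Rightarrow> nat set \<Rightarrow> (nat \<Rightarrow> nat \<Rightarrow> complex) set" where
  "NC_cell_mats r n A =
     {M \<in> cell_mats n A. \<forall>(i, j) \<in> Inv n A - InvQ r n A. M i (pos A j) = 0}"

definition orbit_cell :: "nat \<Rightarrow> nat \<Rightarrow> nat list \<Rightarrow> (nat \<times> nat) set \<Rightarrow> (nat \<Rightarrow> complex) set set" where
  "orbit_cell r n la S = (let A = subset_of r n la in
     colspan r ` {M \<in> NC_cell_mats r n A. \<forall>(i, j) \<in> Inv n A.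
       (box_of n A (i, j) \<in> S \<longrightarrow> M i (pos A j) \<noteq> 0) \<and>
       (box_of n A (i, j) \<in> D r n la - S \<longrightarrow> M i (pos A j) = 0)})"

text \<open>A flag is given by the sequence \<open>V\<^sub>0, V\<^sub>1, \<dots>, V\<^sub>n\<close>; the entries after \<open>V\<^sub>n\<close> all equal \<open>V\<^sub>n\<close>,
  because matrices in \<open>mats n n\<close> have no nonzero column after the \<open>n\<close>-th.\<close>

definition flag_of :: "(nat \<Rightarrow> nat \<Rightarrow> complex) \<Rightarrow> nat \<Rightarrow> (nat \<Rightarrow> complex) set" where
  "flag_of M = (\<lambda>k. colspan k M)"

definition QFl_positions :: "nat \<Rightarrow> (nat \<Rightarrow> nat) \<Rightarrow> (nat \<times> nat) set" where
  "QFl_positions n w = {(i, inv_into UNIV w j) | i j. i \<in> {1..n} \<and> j \<in> {1..n} \<and> i < j \<and>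
     inv_into UNIV w i > inv_into UNIV w j \<and> Transposition.transpose i j \<circ> w \<in> NC n}"

definition QFl_cell :: "nat \<Rightarrow> (nat \<Rightarrow> nat) \<Rightarrow> (nat \<Rightarrow> (nat \<Rightarrow> complex) set) set" where
  "QFl_cell n w = flag_of ` {M \<in> mats n n. (\<forall>j\<in>{1..n}. M (w j) j = 1) \<and>
     (\<forall>i\<in>{1..n}. \<forall>j\<in>{1..n}. i \<noteq> w j \<and> (i, j) \<notin> QFl_positions n w \<longrightarrow> M i j = 0)}"

definition QFl :: "nat \<Rightarrow> (nat \<Rightarrow> (nat \<Rightarrow> complex) set) set" where
  "QFl n = (\<Union>w\<in>NC n. QFl_cell n w)"

definition QGr :: "nat \<Rightarrow> nat \<Rightarrow> (nat \<Rightarrow> complex) set set" where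
  "QGr r n = (\<lambda>V. V r) ` QFl n"


section \<open>Le diagrams and positroid varieties\<close>

definition Le_diagram :: "nat list \<Rightarrow> (nat \<times> nat) set \<Rightarrow> bool" where
  "Le_diagram la L \<longleftrightarrow> L \<subseteq> boxes la \<and>
     (\<forall>(p, q) \<in> boxes la. (\<exists>p'<p. (p', q) \<in> L) \<and> (\<exists>q'<q. (p, q') \<in> L) \<longrightarrow> (p, q) \<in> L)"

definition noncrossing_Le_diagram :: "nat list \<Rightarrow> (nat \<times> nat) set \<Rightarrow> bool" where
  "noncrossing_Le_diagram la L \<longleftrightarrow> Le_diagram la L \<and>
     (\<forall>(p, q) \<in> L. \<not> (\<exists>p'<p. (p', q) \<in> L) \<or> \<not> (\<exists>q'<q. (p, q') \<in> L))"

datatype vertex = Bdry nat | Box "nat \<times> nat"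

definition horizontal_edges :: "nat set \<Rightarrow> (nat \<times> nat) set \<Rightarrow> (vertex \<times> vertex) set" where
  "horizontal_edges A L =
     {(Bdry j, Box (p, q)) | j p q. j \<in> A \<and> p = row_of A j \<and> (p, q) \<in> L \<and>
        (\<forall>q'>q. (p, q') \<notin> L)} \<union>
     {(Box (p, q), Box (p, q')) | p q q'. (p, q) \<in> L \<and> (p, q') \<in> L \<and> q' < q \<and>
        (\<forall>q''. q' < q'' \<and> q'' < q \<longrightarrow> (p, q'') \<notin> L)}"

definition vertical_edges :: "nat \<Rightarrow> nat set \<Rightarrow> (nat \<times> nat) set \<Rightarrow> (vertex \<times> vertex) set" where
  "vertical_edges n A L =
     {(Box (p, q), Box (p', q)) | p p' q. (p, q) \<in> L \<and> (p', q) \<in> L \<and> p < p' \<and>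
        (\<forall>p''. p < p'' \<and> p'' < p' \<longrightarrow> (p'', q) \<notin> L)} \<union>
     {(Box (p, q), Bdry i) | i p q. i \<in> {1..n} - A \<and> q = col_of n A i \<and> (p, q) \<in> L \<and>
        (\<forall>p'>p. (p', q) \<notin> L)}"

definition walks :: "nat \<Rightarrow> nat set \<Rightarrow> (nat \<times> nat) set \<Rightarrow> nat \<Rightarrow> nat \<Rightarrow> vertex list set" where
  "walks n A L j i = {P. P \<noteq> [] \<and> hd P = Bdry j \<and> last P = Bdry i \<and>
     successively (\<lambda>u v. (u, v) \<in> horizontal_edges A L \<union> vertical_edges n A L) P}"

definition walk_weight ::
  "nat set \<Rightarrow> (nat \<times> nat) set \<Rightarrow> (nat \<times> nat \<Rightarrow> complex) \<Rightarrow> vertex list \<Rightarrow> complex" where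
  "walk_weight A L c P =
     (\<Prod>b | \<exists>u. (u, Box b) \<in> set (zip P (tl P)) \<and> (u, Box b) \<in> horizontal_edges A L. c b)"

text \<open>\<open>M\<close> is indexed from 1, matrices of the type \<open>mat\<close> are indexed from 0.\<close>

definition pluecker :: "nat set \<Rightarrow> (nat \<Rightarrow> nat \<Rightarrow> complex) \<Rightarrow> complex" where
  "pluecker B M =
     Determinant.det (mat (card B) (card B) (\<lambda>(k, l). M (sorted_list_of_set B ! k) (Suc l)))"

text \<open>The network has no directed cycles and, for \<open>L \<subseteq> boxes la\<close>, finitely many vertices; so the
  sum over walks is finite.\<close>

definition positroid_cell :: "nat \<Rightarrow> nat \<Rightarrow> nat list \<Rightarrow> (nat \<times> nat) set \<Rightarrow> (nat \<Rightarrow> complex) set set" where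
  "positroid_cell r n la L = (let A = subset_of r n la in
     colspan r ` {M \<in> cell_mats n A. \<exists>c. (\<forall>b\<in>L. c b \<noteq> 0) \<and>
       (\<forall>(i, j) \<in> Inv n A. pluecker (insert i (A - {j})) M / pluecker A M
          = (\<Sum>P \<in> walks n A L j i. walk_weight A L c P))})"

definition positroid_variety ::
  "nat \<Rightarrow> nat \<Rightarrow> nat list \<Rightarrow> (nat \<times> nat) set \<Rightarrow> (nat \<Rightarrow> complex) set set" where
  "positroid_variety r n la L = Gr_closure r n (positroid_cell r n la L)"

end

theory Submission
  imports Defs
begin

text \<open>Label a noncrossing permutation by its blocks. If \<open>w\<close> and \<open>(i j) w\<close> are both noncrossing, then
  \<open>i\<close> and \<open>j\<close> lie in a common block of one of them, call it \<open>v\<close>, and \<open>v\<close> maps \<open>(i, j]\<close> onto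
  \<open>[i, j)\<close>. Counting the elements of \<open>(i, j]\<close> that are at most \<open>r\<close> determines
  \<open>card (A \<inter> (i, j))\<close> up to one, where \<open>A = w [r]\<close>; this numerical condition on the arcs \<open>(i, j)\<close> in
  \<open>Inv\<^sup>Q(A)\<close> forbids two of them to cross, and conversely a single noncrossing permutation realizes
  all arcs that satisfy it. Hence the quasisymmetric Grassmannian is the union of the noncrossing
  cells. Noncrossing arcs that all run from the complement of \<open>A\<close> to \<open>A\<close> form a forest, so the torus
  rescales the nonzero coordinates of a cell arbitrarily. In box coordinates, noncrossing means that
  no box has both a box above it and a box to its left; then the network has at most one walk between
  two boundary vertices, and each positroid cell is equal to the torus orbit, before taking closures.\<close>

section \<open>Noncrossing permutations\<close>

text \<open>Every arc of \<open>InvQ r n A\<close> comes with its own adjacent pair of noncrossing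
  permutations, so two arcs cannot be compared through their witnesses. The numerical condition
  removes the witness: it depends on \<open>r\<close> and \<open>A\<close> only. Its slack of one is
  the question whether \<open>i\<close> itself lies in the image of \<open>[r]\<close>. The
  converse, with one permutation for all arcs, is what the projection needs: a point of a
  noncrossing cell may use all arcs at once, while a flag cell offers only the arcs of its own
  permutation. In the other direction the obstacle is that the first \<open>r\<close> columns of a
  flag matrix need not be reduced. The inequalities in \<open>NC_inversion_bounds\<close> show that
  every column needed for the reduction is a unit vector, so the reduction creates no new entries.
  On the positroid side, Pluecker ratios equal the coordinates only up to sign. Each row of box
  weights realizes arbitrary nonzero suffix products, so the signs are harmless.\<close>

definition cyclic_pred :: "nat set \<Rightarrow> nat \<Rightarrow> nat \<Rightarrow> bool" where
  "cyclic_pred X y x \<longleftrightarrow> x \<in> X \<and> y \<in> X \<and>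
     (y < x \<and> (\<forall>z\<in>X. z \<le> y \<or> x \<le> z) \<or> (\<forall>z\<in>X. x \<le> z) \<and> (\<forall>z\<in>X. z \<le> y))"

text \<open>The third rule is the disjunction at a single point; two instances of it reduce
  uniqueness and injectivity to comparisons of numbers.\<close>

lemma cyclic_predD:
  assumes "cyclic_pred X y x"
  shows "x \<in> X" "y \<in> X" "z \<in> X \<Longrightarrow> y < x \<and> (z \<le> y \<or> x \<le> z) \<or> x \<le> z \<and> z \<le> y"
  using assms unfolding cyclic_pred_def by blast+

lemma cyclic_pred_unique:
  assumes "cyclic_pred X y x" "cyclic_pred X y' x"
  shows "y = y'"
  using cyclic_predD(3)[OF assms(1) cyclic_predD(2)[OF assms(2)]]
    cyclic_predD(3)[OF assms(2) cyclic_predD(2)[OF assms(1)]] by auto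

lemma cyclic_pred_inj:
  assumes "cyclic_pred X y x" "cyclic_pred X y x'"
  shows "x = x'"
  using cyclic_predD(3)[OF assms(1) cyclic_predD(1)[OF assms(2)]]
    cyclic_predD(3)[OF assms(2) cyclic_predD(1)[OF assms(1)]] by auto

text \<open>The entries decrease along the list, so the next entry is the predecessor; the last
  entry, the least, is followed by the first, the largest.\<close>

lemma cyclic_pred_block_cycle:
  assumes "finite X" "x \<in> X"
  shows "cyclic_pred X (block_cycle X x) x"
proof -
  define cs where "cs = rev (sorted_list_of_set X)"
  have set: "set cs = X" and dist: "distinct cs" using assms by (auto simp: cs_def)
  have dec: "cs ! b < cs ! a" if "a < b" "b < length cs" for a b
    using that sorted_wrt_nth_less[OF strict_sorted_list_of_set, of "card X - Suc b" "card X - Suc a" X]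
    by (simp add: cs_def rev_nth)
  have dec': "cs ! b \<le> cs ! a" if "a \<le> b" "b < length cs" for a b
    using dec[of a b] that by (cases "a = b") auto
  obtain k where k: "k < length cs" "x = cs ! k"
    using assms(2) unfolding set[symmetric] in_set_conv_nth by blast
  have "map (cycle_of_list cs) cs = rotate1 cs"
    using cyclic_rotation[OF dist, of 1] by simp
  then have "cycle_of_list cs (cs ! k) = cs ! (Suc k mod length cs)"
    using nth_rotate1[OF k(1)] nth_map[OF k(1), of "cycle_of_list cs"] by simp
  then have bc: "block_cycle X x = cs ! (Suc k mod length cs)"
    by (simp add: block_cycle_def cs_def k(2))
  have "Suc k mod length cs < length cs" using k(1) by (intro mod_less_divisor) linarith
  then have mem: "cs ! (Suc k mod length cs) \<in> X" using set nth_mem by blast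
  have idx: "\<exists>l<length cs. z = cs ! l" if "z \<in> X" for z
    using that unfolding set[symmetric] in_set_conv_nth by blast
  show ?thesis
  proof (cases "Suc k = length cs")
    case True
    have "x \<le> z \<and> z \<le> cs ! 0" if z: "z \<in> X" for z
    proof -
      obtain l where l: "l < length cs" "z = cs ! l" using idx[OF z] by blast
      then have "l \<le> k" using True by linarith
      then show ?thesis unfolding k(2) l(2) using dec'[of l k] dec'[of 0 l] k(1) l(1) by blast
    qed
    moreover have "block_cycle X x = cs ! 0" using bc True by simp
    moreover from this have "block_cycle X x \<in> X" using mem bc by simp
    ultimately show ?thesis unfolding cyclic_pred_def using assms(2) by simp
  next
    case False
    then have k': "Suc k < length cs" using k(1) by linarith
    then have bc': "block_cycle X x = cs ! Suc k" "cs ! Suc k \<in> X" using bc mem by auto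
    have "z \<le> cs ! Suc k \<or> x \<le> z" if z: "z \<in> X" for z
    proof -
      obtain l where l: "l < length cs" "z = cs ! l" using idx[OF z] by blast
      have "l \<le> k \<or> Suc k \<le> l" by linarith
      then show ?thesis unfolding k(2) l(2) using dec'[of l k] dec'[of "Suc k" l] k(1) l(1) by blast
    qed
    moreover have "cs ! Suc k < x" unfolding k(2) using dec[of k "Suc k"] k' by blast
    ultimately show ?thesis unfolding cyclic_pred_def bc'(1) using bc'(2) assms(2) by blast
  qed
qed

text \<open>The cycle of a block keeps its points inside the block, so the cycles of the other
  blocks fix a point both before and after it is moved.\<close>

lemma foldr_block_cycle:
  assumes "distinct Xs" "disjoint (set Xs)" "\<forall>X\<in>set Xs. finite X"
  shows "(\<forall>X\<in>set Xs. \<forall>x\<in>X. foldr (\<circ>) (map block_cycle Xs) id x = block_cycle X x)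
    \<and> (\<forall>x. x \<notin> \<Union>(set Xs) \<longrightarrow> foldr (\<circ>) (map block_cycle Xs) id x = x)"
  using assms
proof (induction Xs)
  case (Cons Y Xs)
  have outside: "block_cycle Z x = x" if "finite Z" "x \<notin> Z" for Z x
    unfolding block_cycle_def using that by (intro id_outside_supp) simp
  have IH: "(\<forall>X\<in>set Xs. \<forall>x\<in>X. foldr (\<circ>) (map block_cycle Xs) id x = block_cycle X x)
    \<and> (\<forall>x. x \<notin> \<Union>(set Xs) \<longrightarrow> foldr (\<circ>) (map block_cycle Xs) id x = x)"
    using Cons.prems by (intro Cons.IH) (simp_all add: pairwise_insert)
  have disj: "Y \<inter> X = {}" if "X \<in> set Xs" for X
    using Cons.prems that by (auto simp: pairwise_insert disjnt_def)
  have head: "foldr (\<circ>) (map block_cycle (Y # Xs)) id x = block_cycle Y x" if "x \<in> Y" for x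
  proof -
    have "x \<notin> \<Union>(set Xs)" using disj that by blast
    then have "foldr (\<circ>) (map block_cycle Xs) id x = x" using IH[THEN conjunct2] by blast
    then show ?thesis by simp
  qed
  have tail: "foldr (\<circ>) (map block_cycle (Y # Xs)) id x = block_cycle X x"
    if "X \<in> set Xs" "x \<in> X" for X x
  proof -
    have "block_cycle X x \<in> X" using cyclic_pred_block_cycle[of X x] that Cons.prems(3)
      by (auto simp: cyclic_pred_def)
    then have "block_cycle Y (block_cycle X x) = block_cycle X x"
      using disj that Cons.prems(3) by (intro outside) auto
    moreover have "foldr (\<circ>) (map block_cycle Xs) id x = block_cycle X x"
      using IH that by blast
    ultimately show ?thesis by simp
  qed
  have out: "foldr (\<circ>) (map block_cycle (Y # Xs)) id x = x" if "x \<notin> \<Union>(set (Y # Xs))" for x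
  proof -
    have "foldr (\<circ>) (map block_cycle Xs) id x = x" using IH[THEN conjunct2] that by simp
    then show ?thesis using outside[of Y x] that Cons.prems(3) by simp
  qed
  show ?case using head tail out by (metis set_ConsD)
qed simp

section \<open>Noncrossing labellings and their permutations\<close>

definition nc_label :: "nat \<Rightarrow> (nat \<Rightarrow> 'b) \<Rightarrow> bool" where
  "nc_label n f \<longleftrightarrow>
     (\<forall>a b c d. 1 \<le> a \<and> a < b \<and> b < c \<and> c < d \<and> d \<le> n \<and> f a = f c \<and> f b = f d \<longrightarrow> f a = f b)"

definition fibre :: "nat \<Rightarrow> (nat \<Rightarrow> 'b) \<Rightarrow> nat \<Rightarrow> nat set" where
  "fibre n f x = {y \<in> {1..n}. f y = f x}"

text \<open>The blocks are encoded as the fibres of a labelling, of any type.\<close>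

definition nc_perm :: "nat \<Rightarrow> (nat \<Rightarrow> 'b) \<Rightarrow> (nat \<Rightarrow> nat) \<Rightarrow> bool" where
  "nc_perm n f w \<longleftrightarrow> nc_label n f \<and> (\<forall>x. x \<notin> {1..n} \<longrightarrow> w x = x)
     \<and> (\<forall>x\<in>{1..n}. cyclic_pred (fibre n f x) (w x) x)"

lemma nc_perm_pred:
  "nc_perm n f w \<Longrightarrow> x \<in> {1..n} \<Longrightarrow> cyclic_pred (fibre n f x) (w x) x"
  by (simp add: nc_perm_def)

lemma nc_perm_label:
  assumes "nc_perm n f w" "x \<in> {1..n}"
  shows "w x \<in> {1..n}" "f (w x) = f x"
  using nc_perm_pred[OF assms] by (auto simp: cyclic_pred_def fibre_def)

text \<open>Only the partition into fibres matters, so labellings with values in different types can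
  be compared.\<close>

lemma nc_perm_cong:
  assumes "nc_perm n f w" "nc_perm n g w'"
    and "\<And>x y. x \<in> {1..n} \<Longrightarrow> y \<in> {1..n} \<Longrightarrow> f x = f y \<longleftrightarrow> g x = g y"
  shows "w = w'"
proof
  fix x
  show "w x = w' x"
  proof (cases "x \<in> {1..n}")
    case True
    then have "fibre n f x = fibre n g x" using assms(3) by (auto simp: fibre_def)
    then show ?thesis using assms(1,2) True cyclic_pred_unique unfolding nc_perm_def by metis
  qed (use assms in \<open>auto simp: nc_perm_def\<close>)
qed

lemma nc_perm_exists:
  assumes "nc_label n f"
  obtains w where "nc_perm n f w" "w \<in> NC n"
proof -
  define P where "P = fibre n f ` {1..n}"
  have fin: "finite P" by (simp add: P_def)
  obtain Xs where Xs: "set Xs = P" "distinct Xs" using finite_distinct_list[OF fin] by blast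
  have part: "partition_on {1..n} P"
    unfolding P_def by (rule partition_onI) (auto simp: fibre_def disjnt_def)
  have nc: "noncrossing P"
    unfolding noncrossing_def
  proof (intro ballI impI)
    fix X Y a b c d
    assume *: "X \<in> P" "Y \<in> P" "a \<in> X" "b \<in> Y" "c \<in> X" "d \<in> Y" "a < b \<and> b < c \<and> c < d"
    then obtain x y where "X = fibre n f x" "Y = fibre n f y" by (auto simp: P_def)
    then have "f a = f c" "f b = f d" "1 \<le> a" "d \<le> n" "X = fibre n f a" "Y = fibre n f b"
      using * by (auto simp: fibre_def)
    moreover from this have "f a = f b"
      using assms[unfolded nc_label_def, rule_format, of a b c d] * by simp
    ultimately show "X = Y" by (simp add: fibre_def)
  qed
  define w where "w = foldr (\<circ>) (map block_cycle Xs) id"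
  have "w \<in> NC n" using Xs part nc unfolding NC_def w_def by blast
  moreover have "nc_perm n f w"
  proof -
    have fb: "\<forall>X\<in>set Xs. finite X" unfolding Xs P_def fibre_def by auto
    have *: "(\<forall>X\<in>P. \<forall>x\<in>X. w x = block_cycle X x) \<and> (\<forall>x. x \<notin> \<Union>P \<longrightarrow> w x = x)"
      using foldr_block_cycle[of Xs] Xs fb part partition_onD2[OF part] unfolding w_def by auto
    have "\<Union>P = {1..n}" using partition_onD1[OF part] by (rule sym)
    moreover have "cyclic_pred (fibre n f x) (w x) x" if "x \<in> {1..n}" for x
      using *[THEN conjunct1] that cyclic_pred_block_cycle[of "fibre n f x" x] fb
      unfolding Xs P_def by (auto simp: fibre_def)
    ultimately show ?thesis using * assms by (simp add: nc_perm_def)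
  qed
  ultimately show ?thesis using that by blast
qed

lemma nc_perm_in_NC:
  assumes "nc_perm n f w"
  shows "w \<in> NC n"
proof -
  have "nc_label n f" using assms by (simp add: nc_perm_def)
  then obtain v where "nc_perm n f v" "v \<in> NC n" using nc_perm_exists by blast
  then show ?thesis using nc_perm_cong[OF assms, of f v] by simp
qed

lemma NC_E:
  assumes "w \<in> NC n"
  obtains f :: "nat \<Rightarrow> nat set" where "nc_perm n f w"
proof -
  obtain Xs where w: "w = foldr (\<circ>) (map block_cycle Xs) id" and Xs: "distinct Xs"
    "partition_on {1..n} (set Xs)" "noncrossing (set Xs)"
    using assms unfolding NC_def by blast
  \<comment> \<open>Each point is labelled by its own block; disjointness makes the description
    definite.\<close>
  define f where "f x = (THE X. X \<in> set Xs \<and> x \<in> X)" for x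
  have f: "f x = X" if "X \<in> set Xs" "x \<in> X" for x X
    unfolding f_def using that partition_onD2[OF Xs(2)]
    by (intro the_equality) (auto simp: disjoint_def)
  have un: "\<Union>(set Xs) = {1..n}" using partition_onD1[OF Xs(2)] by simp
  have mem: "f x \<in> set Xs \<and> x \<in> f x" if "x \<in> {1..n}" for x
  proof -
    have "x \<in> \<Union>(set Xs)" using that un by simp
    then obtain X where X: "X \<in> set Xs" "x \<in> X" by (rule UnionE)
    then show ?thesis using f[OF X] by simp
  qed
  have fib: "fibre n f x = f x" if "x \<in> {1..n}" for x
    using mem[OF that] mem f un that unfolding fibre_def by auto
  have lab: "nc_label n f"
    unfolding nc_label_def
  proof (intro allI impI)
    fix a b c d assume *: "1 \<le> a \<and> a < b \<and> b < c \<and> c < d \<and> d \<le> n \<and> f a = f c \<and> f b = f d"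
    show "f a = f b"
      using Xs(3)[unfolded noncrossing_def, rule_format, of "f a" "f b" a b c d]
        mem[of a] mem[of b] mem[of c] mem[of d] * by auto
  qed
  have fb: "\<forall>X\<in>set Xs. finite X" using un by (metis Union_upper finite_atLeastAtMost finite_subset)
  have *: "(\<forall>X\<in>set Xs. \<forall>x\<in>X. w x = block_cycle X x) \<and> (\<forall>x. x \<notin> \<Union>(set Xs) \<longrightarrow> w x = x)"
    unfolding w using foldr_block_cycle[OF Xs(1) partition_onD2[OF Xs(2)] fb] by auto
  have "nc_perm n f w"
    unfolding nc_perm_def
  proof (intro conjI allI impI ballI)
    fix x assume x: "x \<in> {1..n}"
    have "w x = block_cycle (f x) x" "finite (f x)" using * mem[OF x] fb by blast+
    then show "cyclic_pred (fibre n f x) (w x) x"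
      using fib[OF x] mem[OF x] cyclic_pred_block_cycle[of "f x" x] by simp
  qed (use lab * un in auto)
  then show ?thesis using that by blast
qed

lemma nc_perm_permutes:
  assumes "nc_perm n f w"
  shows "w permutes {1..n}"
proof (rule inj_imp_permutes)
  have cp: "cyclic_pred (fibre n f x) (w x) x" if "x \<in> {1..n}" for x
    using assms that by (simp add: nc_perm_def)
  have fw: "w x \<in> {1..n} \<and> f (w x) = f x" if "x \<in> {1..n}" for x
    using cp[OF that] by (auto simp: cyclic_pred_def fibre_def)
  show "inj_on w {1..n}"
  proof (rule inj_onI)
    fix x y assume *: "x \<in> {1..n}" "y \<in> {1..n}" "w x = w y"
    then have "fibre n f x = fibre n f y" using fw[of x] fw[of y] by (simp add: fibre_def)
    then show "x = y" using cp[of x] cp[of y] * cyclic_pred_inj by metis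
  qed
  show "w x \<in> {1..n}" if "x \<in> {1..n}" for x using fw that by blast
  show "w x = x" if "x \<notin> {1..n}" for x using assms that by (simp add: nc_perm_def)
qed simp

lemma NC_permutes: "w \<in> NC n \<Longrightarrow> w permutes {1..n}"
  using NC_E nc_perm_permutes by metis

text \<open>An element of the block moves down to its predecessor, which is at least
  \<open>i\<close>. An element of another block stays strictly between \<open>i\<close> and
  \<open>j\<close>, since that block cannot cross the pair. Counting turns the inclusion into
  equality.\<close>

lemma nc_perm_interval:
  assumes "nc_perm n f v" "i \<in> {1..n}" "j \<in> {1..n}" "f i = f j" "i < j"
  shows "v ` {i<..j} = {i..<j}"
proof -
  have cp: "cyclic_pred (fibre n f x) (v x) x" if "x \<in> {1..n}" for x
    using assms that by (simp add: nc_perm_def)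
  have lab: "nc_label n f" using assms by (simp add: nc_perm_def)
  have "v x \<in> {i..<j}" if x: "x \<in> {i<..j}" for x
  proof -
    have x': "x \<in> {1..n}" using x assms by auto
    have vx: "v x \<in> {1..n}" "f (v x) = f x"
      using cp[OF x'] by (auto simp: cyclic_pred_def fibre_def)
    show ?thesis
    proof (cases "f x = f i")
      case True
      then have "i \<in> fibre n f x" using assms by (auto simp: fibre_def)
      then have "v x < x" "i \<le> v x"
        using cp[OF x'] x unfolding cyclic_pred_def by fastforce+
      then show ?thesis using x by auto
    next
      case False
      then have "x \<noteq> j" "v x \<noteq> i" "v x \<noteq> j" using vx assms by auto
      moreover have "\<not> v x < i" using lab[unfolded nc_label_def, rule_format, of "v x" i x j]
        False vx assms x \<open>x \<noteq> j\<close> by auto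
      moreover have "\<not> j < v x" using lab[unfolded nc_label_def, rule_format, of i x j "v x"]
        False vx assms x \<open>x \<noteq> j\<close> by auto
      ultimately show ?thesis by auto
    qed
  qed
  then have "v ` {i<..j} \<subseteq> {i..<j}" by blast
  moreover have "card (v ` {i<..j}) = card {i..<j}"
    using nc_perm_permutes[OF assms(1)] by (subst card_image) (auto simp: permutes_inj_on)
  ultimately show ?thesis by (intro card_subset_eq) auto
qed

text \<open>The transposition cuts the common block into its elements in \<open>(i, j]\<close>, now
  a cycle with largest element \<open>j\<close>, and the rest, which keeps \<open>i\<close>. The
  second component of the new label records the side of the cut and is constantly
  \<open>False\<close> on other blocks.\<close>

lemma nc_perm_split:
  fixes f :: "nat \<Rightarrow> 'b"
  assumes "nc_perm n f v" "i \<in> {1..n}" "j \<in> {1..n}" "f i = f j" "i < j"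
  shows "nc_perm n (\<lambda>y. (f y, f y = f i \<and> y \<in> {i<..j})) (Transposition.transpose i j \<circ> v)"
proof -
  let ?g = "\<lambda>y. (f y, f y = f i \<and> y \<in> {i<..j})"
  have cp: "cyclic_pred (fibre n f x) (v x) x" if "x \<in> {1..n}" for x
    using assms that by (simp add: nc_perm_def)
  have lab: "nc_label n f" using assms by (simp add: nc_perm_def)
  have "nc_label n ?g"
    unfolding nc_label_def
  proof (intro allI impI)
    fix a b c d
    assume *: "1 \<le> a \<and> a < b \<and> b < c \<and> c < d \<and> d \<le> n \<and> ?g a = ?g c \<and> ?g b = ?g d"
    then have "f a = f b" using lab[unfolded nc_label_def, rule_format, of a b c d] by auto
    then show "?g a = ?g b" using * by auto
  qed
  moreover have "(Transposition.transpose i j \<circ> v) x = x" if "x \<notin> {1..n}" for x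
  proof -
    have "v x = x" using assms(1) that by (simp add: nc_perm_def)
    moreover have "x \<noteq> i" "x \<noteq> j" using that assms by auto
    ultimately show ?thesis by simp
  qed
  moreover have "cyclic_pred (fibre n ?g x) ((Transposition.transpose i j \<circ> v) x) x"
    if x: "x \<in> {1..n}" for x
  proof (cases "f x = f i")
    case False
    then have eq: "fibre n ?g x = fibre n f x" by (auto simp: fibre_def)
    have "f (v x) = f x" using cp[OF x] by (auto simp: cyclic_pred_def fibre_def)
    then have "v x \<noteq> i" "v x \<noteq> j" using False assms by auto
    then show ?thesis using cp[OF x] unfolding eq by simp
  next
    case True
    define X where "X = fibre n f x"
    have ij: "i \<in> X" "j \<in> X" "x \<in> X" using True assms x by (auto simp: X_def fibre_def)
    have cpx: "cyclic_pred X (v x) x" using cp[OF x] by (simp add: X_def)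
    have eq: "fibre n ?g x = {y \<in> X. (y \<in> {i<..j}) = (x \<in> {i<..j})}"
      using True by (auto simp: fibre_def X_def)
    consider "v x = i" | "v x = j" | "v x \<noteq> i" "v x \<noteq> j" by blast
    then show ?thesis
    proof cases
      case 1
      then have "(Transposition.transpose i j \<circ> v) x = j" by simp
      moreover have "cyclic_pred {y \<in> X. (y \<in> {i<..j}) = (x \<in> {i<..j})} j x"
      proof -
        \<comment> \<open>No wrap-around here: \<open>i\<close> is not the largest element of the
          block, as \<open>j\<close> belongs to it. So \<open>x\<close> directly follows
          \<open>i\<close> and is the least element of the part in \<open>(i, j]\<close>.\<close>
        have x: "i < x" "\<And>z. z \<in> X \<Longrightarrow> z \<le> i \<or> x \<le> z"
          using cpx ij \<open>i < j\<close> unfolding cyclic_pred_def 1 by auto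
        then have "x \<le> j" using ij(2) \<open>i < j\<close> by fastforce
        then show ?thesis using x ij \<open>i < j\<close> by (force simp: cyclic_pred_def)
      qed
      ultimately show ?thesis unfolding eq by simp
    next
      case 2
      then have "(Transposition.transpose i j \<circ> v) x = i" by simp
      moreover have "cyclic_pred {y \<in> X. (y \<in> {i<..j}) = (x \<in> {i<..j})} i x"
      proof -
        \<comment> \<open>Here \<open>x\<close> follows \<open>j\<close>, either directly or by
          wrap-around; once the elements of \<open>(i, j]\<close> are taken out, it follows
          \<open>i\<close> in the same way.\<close>
        have "j < x \<and> (\<forall>z\<in>X. z \<le> j \<or> x \<le> z) \<or> (\<forall>z\<in>X. x \<le> z) \<and> (\<forall>z\<in>X. z \<le> j)"
          using cpx unfolding cyclic_pred_def 2 by blast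
        then show ?thesis
        proof (elim disjE conjE)
          assume "j < x" "\<forall>z\<in>X. z \<le> j \<or> x \<le> z"
          then show ?thesis using ij \<open>i < j\<close> by (force simp: cyclic_pred_def)
        next
          assume "\<forall>z\<in>X. x \<le> z" "\<forall>z\<in>X. z \<le> j"
          then show ?thesis using ij \<open>i < j\<close> by (force simp: cyclic_pred_def)
        qed
      qed
      ultimately show ?thesis unfolding eq by simp
    next
      case 3
      then have "(Transposition.transpose i j \<circ> v) x = v x" by simp
      moreover have "cyclic_pred {y \<in> X. (y \<in> {i<..j}) = (x \<in> {i<..j})} (v x) x"
      proof -
        have vX: "v x \<in> X" using cpx by (simp add: cyclic_pred_def)
        have "v x < x \<and> (\<forall>z\<in>X. z \<le> v x \<or> x \<le> z) \<or> (\<forall>z\<in>X. x \<le> z) \<and> (\<forall>z\<in>X. z \<le> v x)"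
          using cpx unfolding cyclic_pred_def by blast
        then show ?thesis
        proof (elim disjE conjE)
          assume *: "v x < x" "\<forall>z\<in>X. z \<le> v x \<or> x \<le> z"
          then have "i \<le> v x \<or> x \<le> i" "j \<le> v x \<or> x \<le> j" using ij by auto
          then have "v x \<in> {i<..j} \<longleftrightarrow> x \<in> {i<..j}" using * 3 \<open>i < j\<close> by auto
          then show ?thesis using * vX ij by (auto simp: cyclic_pred_def)
        next
          assume *: "\<forall>z\<in>X. x \<le> z" "\<forall>z\<in>X. z \<le> v x"
          then have "x \<le> i" "j < v x" using ij 3 by force+
          then show ?thesis using * vX ij by (auto simp: cyclic_pred_def)
        qed
      qed
      ultimately show ?thesis unfolding eq by simp
    qed
  qed
  ultimately show ?thesis unfolding nc_perm_def by blast
qed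

text \<open>The cut read backwards, as a transposition is an involution: the last assumption says
  that \<open>f\<close> arises from the noncrossing labelling \<open>g\<close> by cutting the block
  of \<open>i\<close> and \<open>j\<close>.\<close>

lemma nc_perm_merge:
  assumes w: "nc_perm n f w" and g: "nc_label n g"
    and ij: "i \<in> {1..n}" "j \<in> {1..n}" "i < j" "g i = g j"
    and fg: "\<And>x y. x \<in> {1..n} \<Longrightarrow> y \<in> {1..n} \<Longrightarrow>
      f x = f y \<longleftrightarrow> g x = g y \<and> ((g x = g i \<and> x \<in> {i<..j}) = (g y = g i \<and> y \<in> {i<..j}))"
  shows "Transposition.transpose i j \<circ> w \<in> NC n"
proof -
  obtain v where v: "nc_perm n g v" "v \<in> NC n" using nc_perm_exists[OF g] .
  have "w = Transposition.transpose i j \<circ> v"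
    by (rule nc_perm_cong[OF w nc_perm_split[OF v(1) ij(1,2,4,3)]]) (simp add: fg)
  then have "Transposition.transpose i j \<circ> w = v" by (auto simp: fun_eq_iff)
  then show ?thesis using v by simp
qed

text \<open>A cycle is exhausted from any of its points by taking preimages. Concretely,
  \<open>Z\<close> climbs from \<open>x\<close> to the largest element of the block;
  \<open>w\<close> sends the least element to the largest, so the least one is in \<open>Z\<close>
  as well, and the climb from there covers the block.\<close>

lemma nc_perm_block_generated:
  assumes w: "nc_perm n f w" and x: "x \<in> {1..n}" "x \<in> Z" and y: "y \<in> {1..n}" "f x = f y"
    and step: "\<And>z. z \<in> {1..n} \<Longrightarrow> f z = f x \<Longrightarrow> w z \<in> Z \<Longrightarrow> z \<in> Z"
  shows "y \<in> Z"
proof -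
  define X where "X = fibre n f x"
  have cp: "cyclic_pred X (w z) z" if "z \<in> X" for z
  proof -
    have "fibre n f z = X" using that by (auto simp: X_def fibre_def)
    moreover have "z \<in> {1..n}" using that by (simp add: X_def fibre_def)
    ultimately show ?thesis using nc_perm_pred[OF w, of z] by simp
  qed
  have fin: "finite X" and ne: "x \<in> X" "y \<in> X" using x y by (auto simp: X_def fibre_def)
  have st: "z \<in> Z" if "z \<in> X" "w z \<in> Z" for z
    using that by (intro step[of z]) (auto simp: X_def fibre_def)
  have up: "u \<in> Z" if "u \<in> X" "a \<in> X" "a \<in> Z" "a \<le> u" for a u
    using that
  proof (induction u rule: less_induct)
    case (less u)
    show ?case
    proof (cases "a = u")
      case False
      then have "a < u" using less.prems by simp
      then have "\<not> (\<forall>z\<in>X. u \<le> z)" using less.prems(2) by (meson leD)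
      then have wu: "w u \<in> X" "w u < u" "\<forall>z\<in>X. z \<le> w u \<or> u \<le> z"
        using cp[OF less.prems(1)] unfolding cyclic_pred_def by blast+
      then have "a \<le> w u" using less.prems(2) \<open>a < u\<close> by (meson leD)
      then have "w u \<in> Z" using less.IH[OF wu(2,1) less.prems(2,3)] by blast
      then show ?thesis by (rule st[OF less.prems(1)])
    qed (use less.prems in simp)
  qed
  have "X \<noteq> {}" using ne by blast
  then have m: "Min X \<in> X" "Max X \<in> X" "\<And>z. z \<in> X \<Longrightarrow> Min X \<le> z \<and> z \<le> Max X"
    using fin by auto
  have "Max X \<in> Z" using up[OF m(2) ne(1) x(2)] m(3)[OF ne(1)] by simp
  moreover have "w (Min X) = Max X"
  proof -
    have "\<not> w (Min X) < Min X" using cp[OF m(1)] m(3) unfolding cyclic_pred_def by (meson leD)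
    then have "w (Min X) \<in> X \<and> (\<forall>z\<in>X. z \<le> w (Min X))"
      using cp[OF m(1)] unfolding cyclic_pred_def by blast
    then show ?thesis using m by (meson le_antisym)
  qed
  ultimately have "Min X \<in> Z" using st[OF m(1)] by simp
  then show ?thesis using up[OF ne(2) m(1)] m(3)[OF ne(2)] by simp
qed

text \<open>A transposition joins the cycles of \<open>i\<close> and \<open>j\<close> if they
  differ. The proof starts at the point \<open>x\<close> that \<open>w\<close> sends to
  \<open>j\<close> and the new permutation to \<open>i\<close>, and follows the
  \<open>w\<close>-cycle of \<open>j\<close> backwards. As long as \<open>j\<close> is not met as an
  image the two permutations agree there, so the whole cycle, \<open>j\<close> included, lies in the
  \<open>g\<close>-class of \<open>i\<close>.\<close>

lemma nc_perm_transpose_same_block: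
  assumes w: "nc_perm n f w" and u: "nc_perm n g (Transposition.transpose i j \<circ> w)"
    and ij: "i \<in> {1..n}" "j \<in> {1..n}"
  shows "f i = f j \<or> g i = g j"
proof (rule disjCI, rule ccontr)
  let ?u = "Transposition.transpose i j \<circ> w"
  assume ng: "g i \<noteq> g j" and nf: "f i \<noteq> f j"
  have wp: "w permutes {1..n}" using w nc_perm_permutes by blast
  note fw = nc_perm_label(2)[OF w] and gu = nc_perm_label(2)[OF u]
  have "j \<in> w ` {1..n}" using permutes_image[OF wp] ij by simp
  then obtain x where x: "x \<in> {1..n}" "w x = j" by blast
  have "f x = f j" using fw[OF x(1)] x by simp
  have "g x = g i" using gu[OF x(1)] x by simp
  have "j \<in> {z. g z = g i}"
  proof (rule nc_perm_block_generated[OF w x(1) _ ij(2) \<open>f x = f j\<close>])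
    show "x \<in> {z. g z = g i}" using \<open>g x = g i\<close> by simp
    fix z assume z: "z \<in> {1..n}" "f z = f x" "w z \<in> {z. g z = g i}"
    then have "w z \<noteq> j" using ng by auto
    moreover have "w z \<noteq> i" using fw[OF z(1)] z \<open>f x = f j\<close> nf by auto
    ultimately show "z \<in> {z. g z = g i}" using gu[OF z(1)] z by simp
  qed
  then show False using ng by simp
qed

section \<open>The arcs of the quasisymmetric Johnson graph\<close>

lemma transpose_image_swap:
  assumes "j \<in> A" "i \<notin> A"
  shows "Transposition.transpose i j ` A = insert i (A - {j})"
proof -
  have "Transposition.transpose i j ` A = Transposition.transpose i j ` (insert j (A - {j}))"
    by (simp only: insert_Diff[OF assms(1)])
  also have "\<dots> = insert i (Transposition.transpose i j ` (A - {j}))"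
    by (simp only: image_insert transpose_apply_second)
  also have "Transposition.transpose i j ` (A - {j}) = A - {j}"
    using assms(2) by (force simp: Transposition.transpose_def image_iff)
  finally show ?thesis .
qed

text \<open>An edge records two sets and some transposition \<open>(a b)\<close>. This transposition
  takes \<open>j\<close> out of \<open>A\<close> and brings \<open>i\<close> in, so it moves both of
  them and must be \<open>(i j)\<close>.\<close>

lemma InvQ_E:
  assumes "(i, j) \<in> InvQ r n A"
  obtains w where "w \<in> NC n" "w ` {1..r} = A" "Transposition.transpose i j \<circ> w \<in> NC n"
proof -
  have ij: "i \<notin> A" "j \<in> A" "i < j" using assms by (auto simp: InvQ_def Inv_def)
  have "QJ_edge r n A (insert i (A - {j}))" using assms by (simp add: InvQ_def)
  then have "\<exists>w u. kreweras_adjacent n w u \<and> A = w ` {1..r} \<and> insert i (A - {j}) = u ` {1..r}"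
    unfolding QJ_edge_def by (elim conjE)
  then obtain w u where wu: "kreweras_adjacent n w u" "w ` {1..r} = A"
    "u ` {1..r} = insert i (A - {j})"
    by (elim exE conjE) simp
  then obtain a b where ab: "w = Transposition.transpose a b \<circ> u"
    and NC: "w \<in> NC n" "u \<in> NC n"
    unfolding kreweras_adjacent_def by blast
  have u: "u = Transposition.transpose a b \<circ> w" unfolding ab by (simp add: fun_eq_iff)
  have "u ` {1..r} = Transposition.transpose a b ` w ` {1..r}" unfolding u by (simp only: image_comp)
  then have img: "Transposition.transpose a b ` A = insert i (A - {j})" using wu(2,3) by simp
  have "j \<in> {a, b}"
  proof (rule ccontr)
    assume "j \<notin> {a, b}"
    then have "Transposition.transpose a b j = j" by simp
    then have "j \<in> Transposition.transpose a b ` A" using ij(2) by (metis imageI)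
    then show False using img ij by simp
  qed
  moreover have "i \<in> {a, b}"
  proof (rule ccontr)
    assume *: "i \<notin> {a, b}"
    have "i \<in> Transposition.transpose a b ` A" using img by simp
    then obtain x where "x \<in> A" "i = Transposition.transpose a b x" by blast
    then show False using * ij(1) by (cases "x \<in> {a, b}") auto
  qed
  ultimately have "Transposition.transpose a b = Transposition.transpose i j"
    using ij(3) by (auto simp: transpose_commute)
  then show ?thesis using that[OF NC(1) wu(2)] NC(2) unfolding u by simp
qed

lemma InvQ_I:
  assumes "w \<in> NC n" "w ` {1..r} = A" "A \<in> subsets r n" "(i, j) \<in> Inv n A"
    and "Transposition.transpose i j \<circ> w \<in> NC n"
  shows "(i, j) \<in> InvQ r n A"
proof -
  have ij: "i \<notin> A" "j \<in> A" "i < j" "i \<in> {1..n}" using assms(4) by (auto simp: Inv_def)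
  have A: "A \<subseteq> {1..n}" "card A = r" using assms(3) by (auto simp: subsets_def)
  then have fin: "finite A" using finite_subset by blast
  let ?u = "Transposition.transpose i j \<circ> w"
  have img: "?u ` {1..r} = insert i (A - {j})"
    using transpose_image_swap[OF ij(2,1)] assms(2) by (metis image_comp)
  have w: "w = Transposition.transpose i j \<circ> ?u" by (auto simp: fun_eq_iff)
  have "kreweras_adjacent n w ?u"
    unfolding kreweras_adjacent_def using assms(1,5) w ij(3) by (metis less_irrefl)
  moreover have "insert i (A - {j}) \<in> subsets r n"
  proof -
    have "card (insert i (A - {j})) = r"
      using ij A fin card_gt_0_iff[of A] by (auto simp: card_insert_if)
    then show ?thesis using ij A by (auto simp: subsets_def)
  qed
  ultimately have "QJ_edge r n A (insert i (A - {j}))"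
    unfolding QJ_edge_def using assms(2,3) img ij by blast
  then show ?thesis using assms(4) by (simp add: InvQ_def)
qed

text \<open>If \<open>v\<close> maps \<open>(i, j]\<close> onto \<open>[i, j)\<close>, then
  \<open>v [r]\<close> has as many elements in \<open>[i, j)\<close> as \<open>[r]\<close> has in
  \<open>(i, j]\<close>: this is \<open>min r j - i\<close>, where truncation gives the correct
  value 0 for \<open>r \<le> i\<close>. Leaving out the point \<open>i\<close> loses at most one
  element.\<close>

definition quasi_arc :: "nat \<Rightarrow> nat set \<Rightarrow> nat \<Rightarrow> nat \<Rightarrow> bool" where
  "quasi_arc r A i j \<longleftrightarrow>
     card (A \<inter> {i<..<j}) \<le> min r j - i \<and> min r j - i \<le> Suc (card (A \<inter> {i<..<j}))"

lemma nc_perm_quasi_arc: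
  assumes v: "nc_perm n f v" and ij: "i \<in> {1..n}" "j \<in> {1..n}" "f i = f j" "i < j"
  shows "quasi_arc r (v ` {1..r}) i j"
proof -
  have inj: "inj v" using nc_perm_permutes[OF v] permutes_inj by blast
  have int: "v ` {i<..j} = {i..<j}" using nc_perm_interval[OF v ij] .
  have eq: "v ` {1..r} \<inter> {i<..<j} = v ` {i<..min r j} - {i}"
  proof -
    have "{i<..<j} = v ` {i<..j} - {i}" unfolding int by auto
    then have "v ` {1..r} \<inter> {i<..<j} = v ` ({1..r} \<inter> {i<..j}) - {i}"
      by (simp add: image_Int[OF inj] Int_Diff)
    moreover have "{1..r} \<inter> {i<..j} = {i<..min r j}" by auto
    ultimately show ?thesis by simp
  qed
  have card: "card (v ` {i<..min r j}) = min r j - i"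
    using inj by (subst card_image) (auto intro: inj_on_subset)
  show ?thesis
  proof (cases "i \<in> v ` {i<..min r j}")
    case True
    then have "card (v ` {i<..min r j} - {i}) = min r j - i - 1"
      by (simp only: card_Diff_singleton card)
    then show ?thesis unfolding quasi_arc_def eq by linarith
  next
    case False
    then show ?thesis unfolding quasi_arc_def eq by (simp add: card)
  qed
qed

text \<open>The block containing both ends may belong to \<open>w\<close> or to
  \<open>(i j) w\<close>. These send \<open>[r]\<close> to \<open>A\<close> and to
  \<open>insert i (A - {j})\<close>, which agree strictly between \<open>i\<close> and
  \<open>j\<close>, and the condition sees no more than that.\<close>

lemma InvQ_quasi_arc:
  assumes "(i, j) \<in> InvQ r n A" "A \<subseteq> {1..n}"
  shows "quasi_arc r A i j"
proof -
  have ij: "i \<notin> A" "j \<in> A" "i < j" "i \<in> {1..n}" "j \<in> {1..n}"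
    using assms by (auto simp: InvQ_def Inv_def)
  obtain w where w: "w \<in> NC n" "w ` {1..r} = A" "Transposition.transpose i j \<circ> w \<in> NC n"
    using InvQ_E[OF assms(1)] .
  obtain f :: "nat \<Rightarrow> nat set" where f: "nc_perm n f w" using NC_E[OF w(1)] .
  obtain g :: "nat \<Rightarrow> nat set" where g: "nc_perm n g (Transposition.transpose i j \<circ> w)"
    using NC_E[OF w(3)] .
  have img: "(Transposition.transpose i j \<circ> w) ` {1..r} = insert i (A - {j})"
    using transpose_image_swap[OF ij(2,1)] w(2) by (metis image_comp)
  have "insert i (A - {j}) \<inter> {i<..<j} = A \<inter> {i<..<j}" by auto
  then have "quasi_arc r (insert i (A - {j})) i j \<longleftrightarrow> quasi_arc r A i j"
    by (simp add: quasi_arc_def)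
  then show ?thesis
    using nc_perm_transpose_same_block[OF f g ij(4,5)] nc_perm_quasi_arc[OF f ij(4,5) _ ij(3), of r]
      nc_perm_quasi_arc[OF g ij(4,5) _ ij(3), of r] w(2) img by metis
qed

text \<open>Let \<open>c\<close> be the number of elements of \<open>A\<close> strictly between
  \<open>i\<close> and \<open>j\<close>. As \<open>i\<close> is not in \<open>A\<close>, the arc
  \<open>(i', j)\<close> gives \<open>min r j \<le> i + c\<close>; as \<open>j\<close> is in
  \<open>A\<close>, the arc \<open>(i, j')\<close> gives \<open>i + c < min r j'\<close>. Hence
  \<open>min r j < r\<close>, so \<open>min r j = j\<close>, and \<open>j \<le> i + c\<close>
  contradicts \<open>c < j - i\<close>.\<close>

lemma quasi_arc_noncrossing:
  assumes "quasi_arc r A i' j" "quasi_arc r A i j'" "i \<notin> A" "j \<in> A"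
  shows "\<not> (i' < i \<and> i < j \<and> j < j')"
proof
  assume *: "i' < i \<and> i < j \<and> j < j'"
  have c1: "card (A \<inter> {i'<..<j}) \<le> i - i' - 1 + card (A \<inter> {i<..<j})"
  proof -
    have "A \<inter> {i'<..<j} \<subseteq> {i'<..<i} \<union> (A \<inter> {i<..<j})"
    proof
      fix x assume "x \<in> A \<inter> {i'<..<j}"
      then show "x \<in> {i'<..<i} \<union> (A \<inter> {i<..<j})" using assms(3) by (cases x i rule: linorder_cases) auto
    qed
    then have "card (A \<inter> {i'<..<j}) \<le> card ({i'<..<i} \<union> (A \<inter> {i<..<j}))" by (intro card_mono) auto
    also have "\<dots> \<le> card {i'<..<i} + card (A \<inter> {i<..<j})" by (rule card_Un_le)
    finally show ?thesis by simp
  qed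
  have c2: "Suc (card (A \<inter> {i<..<j})) \<le> card (A \<inter> {i<..<j'})"
  proof -
    have "insert j (A \<inter> {i<..<j}) \<subseteq> A \<inter> {i<..<j'}" using * assms(4) by auto
    then have "card (insert j (A \<inter> {i<..<j})) \<le> card (A \<inter> {i<..<j'})" by (intro card_mono) auto
    then show ?thesis by simp
  qed
  have c0: "card (A \<inter> {i<..<j}) \<le> j - i - 1"
  proof -
    have "card (A \<inter> {i<..<j}) \<le> card {i<..<j}" by (intro card_mono) auto
    then show ?thesis by simp
  qed
  have "min r j - i' \<le> Suc (card (A \<inter> {i'<..<j}))" "card (A \<inter> {i<..<j'}) \<le> min r j' - i"
    using assms(1,2) by (auto simp: quasi_arc_def)
  then show False using c0 c1 c2 * by (simp add: min_def split: if_splits)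
qed

lemma InvQ_noncrossing:
  assumes "(i', j) \<in> InvQ r n A" "(i, j') \<in> InvQ r n A" "A \<subseteq> {1..n}"
  shows "\<not> (i' < i \<and> i < j \<and> j < j')"
proof (rule quasi_arc_noncrossing)
  show "i \<notin> A" "j \<in> A" using assms(1,2) by (auto simp: InvQ_def Inv_def)
qed (use assms InvQ_quasi_arc in auto)

text \<open>Whichever of \<open>w\<close> and \<open>(i j) w\<close> has \<open>i\<close> and
  \<open>j\<close> in one block takes some element of \<open>(i, j]\<close> to \<open>i\<close>;
  under \<open>w\<close> this element goes to \<open>i\<close> or to \<open>j\<close>. Since the
  preimages are inverted, either case yields both bounds. They are used to recognize unit columns in
  flag matrices.\<close>

lemma NC_inversion_bounds:
  assumes "w \<in> NC n" "Transposition.transpose i j \<circ> w \<in> NC n" "i \<in> {1..n}" "j \<in> {1..n}" "i < j"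
    and lt: "inv_into UNIV w j < inv_into UNIV w i"
  shows "inv_into UNIV w j \<le> j" "i < inv_into UNIV w i"
proof -
  obtain f :: "nat \<Rightarrow> nat set" where f: "nc_perm n f w" using NC_E[OF assms(1)] .
  obtain g :: "nat \<Rightarrow> nat set" where g: "nc_perm n g (Transposition.transpose i j \<circ> w)"
    using NC_E[OF assms(2)] .
  have inj: "inj w" using nc_perm_permutes[OF f] permutes_inj by blast
  have "i < inv_into UNIV w i \<and> inv_into UNIV w i \<le> j \<or> i < inv_into UNIV w j \<and> inv_into UNIV w j \<le> j"
    using nc_perm_transpose_same_block[OF f g assms(3,4)]
  proof
    assume "f i = f j"
    then have "i \<in> w ` {i<..j}" using nc_perm_interval[OF f assms(3,4) _ assms(5)] assms(5) by simp
    then obtain x where "x \<in> {i<..j}" "w x = i" by blast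
    then show ?thesis using inj by auto
  next
    assume "g i = g j"
    then have "i \<in> (Transposition.transpose i j \<circ> w) ` {i<..j}"
      using nc_perm_interval[OF g assms(3,4) _ assms(5)] assms(5) by simp
    then obtain x where x: "x \<in> {i<..j}" "Transposition.transpose i j (w x) = i" by auto
    then have "w x = j" by (metis transpose_apply_first transpose_involutory)
    then show ?thesis using inj x(1) by auto
  qed
  then show "inv_into UNIV w j \<le> j" "i < inv_into UNIV w i" using lt by auto
qed

section \<open>A noncrossing permutation realizing all arcs at once\<close>

definition cap_label :: "nat set \<Rightarrow> (nat \<Rightarrow> nat) \<Rightarrow> nat \<Rightarrow> nat + nat" where
  "cap_label S m x = (if x \<in> S then Inr x else Inl (m x))"

text \<open>Level sets of a function that rises up to \<open>r\<close> and falls afterwards are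
  nested around \<open>r\<close>, and singletons never cross anything. The set and the heights stay
  general because the labellings with two blocks joined have the same form.\<close>

lemma nc_label_cap_label:
  assumes up: "\<And>x y. x \<le> y \<Longrightarrow> y \<le> r \<Longrightarrow> m x \<le> m y"
    and down: "\<And>x y. r < x \<Longrightarrow> x \<le> y \<Longrightarrow> m y \<le> m x"
  shows "nc_label n (cap_label S m)"
  unfolding nc_label_def
proof (intro allI impI)
  fix a b c d
  assume *: "1 \<le> a \<and> a < b \<and> b < c \<and> c < d \<and> d \<le> n \<and>
    cap_label S m a = cap_label S m c \<and> cap_label S m b = cap_label S m d"
  then have S: "a \<notin> S" "b \<notin> S" and m: "m a = m c" "m b = m d"
    by (auto simp: cap_label_def split: if_splits)
  have "m a \<le> m b" using up[of a b] down[of b c] * m by (cases "b \<le> r") auto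
  moreover have "m b \<le> m a" using up[of b c] down[of c d] * m by (cases "c \<le> r") auto
  ultimately show "cap_label S m a = cap_label S m b" using S by (simp add: cap_label_def)
qed

text \<open>Every level up to \<open>card Q\<close> is attained on \<open>Q\<close>; this provides
  the partner of an element of \<open>[r] - A\<close>.\<close>

lemma ex_rank:
  assumes "finite (Q :: nat set)" "1 \<le> t" "t \<le> card Q"
  shows "\<exists>q\<in>Q. card (Q \<inter> {q..}) = t"
  using assms
proof (induction Q rule: finite_linorder_min_induct)
  case (insert b Q)
  have *: "insert b Q \<inter> {q..} = Q \<inter> {q..}" if "q \<in> Q" for q using that insert by force
  have "insert b Q \<inter> {b..} = insert b Q" using insert by force
  then have "card (insert b Q \<inter> {b..}) = Suc (card Q)" using insert by force
  then show ?case using insert * by (cases "t = Suc (card Q)") force+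
qed simp

text \<open>The blocks join each element of \<open>[r] - A\<close> to the element of \<open>A - [r]\<close> nested with it; an
  element of \<open>[n] - [r]\<close> outside \<open>A\<close> belongs to the block of the next element of \<open>A\<close>, and the
  elements of \<open>A \<inter> [r]\<close> are singletons.\<close>

lemma NC_representative:
  assumes "A \<in> subsets r n" "r \<le> n"
  obtains w where "w \<in> NC n" "w ` {1..r} = A"
    "\<And>i j. (i, j) \<in> Inv n A \<Longrightarrow> quasi_arc r A i j \<Longrightarrow> Transposition.transpose i j \<circ> w \<in> NC n"
proof -
  have A: "A \<subseteq> {1..n}" "card A = r" using assms(1) by (auto simp: subsets_def)
  have finA: "finite A" using A finite_subset by blast
  define P where "P = {1..r} - A"
  define Q where "Q = A - {1..r}"
  define S where "S = A \<inter> {1..r}"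
  \<comment> \<open>The nesting level: the \<open>k\<close>-th element of \<open>P\<close> from the
    left and the \<open>k\<close>-th element of \<open>Q\<close> from the right both have level
    \<open>k\<close>.\<close>
  define m where "m x = (if x \<le> r then card (P \<inter> {..x}) else card (Q \<inter> {x..}))" for x
  define f where "f = cap_label S m"
  have fin: "finite P" "finite Q" using finA by (auto simp: P_def Q_def)
  have cardPQ: "card P = card Q"
  proof -
    have "card P = card {1..r} - card S" unfolding P_def S_def
      by (metis Int_commute card_Diff_subset_Int finA finite_Int)
    moreover have "card Q = card A - card S" unfolding Q_def S_def
      by (metis card_Diff_subset_Int finA finite_Int)
    ultimately show ?thesis using A by simp
  qed
  have up: "m x \<le> m y" if "x \<le> y" "y \<le> r" for x y
    using that fin by (auto simp: m_def intro!: card_mono)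
  have down: "m y \<le> m x" if "r < x" "x \<le> y" for x y
    using that fin by (auto simp: m_def intro!: card_mono)
  have up': "m x < m y" if "x < y" "y \<in> P" for x y
  proof -
    have "y \<le> r" using that by (simp add: P_def)
    then have "P \<inter> {..x} \<subset> P \<inter> {..y}" using that by force
    then have "card (P \<inter> {..x}) < card (P \<inter> {..y})" using fin by (intro psubset_card_mono) auto
    then show ?thesis using that \<open>y \<le> r\<close> by (simp add: m_def)
  qed
  have down': "m y < m x" if "x < y" "x \<in> Q" for x y
  proof -
    have "x \<in> {1..n}" "x \<notin> {1..r}" using that(2) A(1) by (auto simp: Q_def)
    then have "r < x" by simp
    have "x \<in> Q \<inter> {x..}" "x \<notin> Q \<inter> {y..}" "Q \<inter> {y..} \<subseteq> Q \<inter> {x..}" using that by auto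
    then have "Q \<inter> {y..} \<subset> Q \<inter> {x..}" by blast
    then have "card (Q \<inter> {y..}) < card (Q \<inter> {x..})" using fin by (intro psubset_card_mono) auto
    then show ?thesis using that(1) \<open>r < x\<close> by (simp add: m_def)
  qed
  have lab: "nc_label n f" unfolding f_def by (rule nc_label_cap_label[OF up down])
  obtain w where w: "nc_perm n f w" "w \<in> NC n" using nc_perm_exists[OF lab] .
  have wA: "w x \<in> A" if x: "x \<in> {1..r}" for x
  proof -
    have xn: "x \<in> {1..n}" using x assms(2) by simp
    have lw: "w x \<in> {1..n}" "f (w x) = f x" using nc_perm_label[OF w(1) xn] .
    show ?thesis
    proof (cases "x \<in> A")
      case True
      then have "w x = x" using lw(2) x by (auto simp: f_def cap_label_def S_def split: if_splits)
      then show ?thesis using True by simp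
    next
      case False
      then have xP: "x \<in> P" and xS: "x \<notin> S" using x by (auto simp: P_def S_def)
      \<comment> \<open>The level increases at each element of \<open>P\<close> and drops after each
        element of \<open>Q\<close>. So \<open>x\<close> is the least element of its block,
        \<open>w\<close> takes it to the largest, and this is the element of \<open>Q\<close> of the
        same level.\<close>
      have min: "x \<le> z" if "z \<in> fibre n f x" for z
      proof (rule ccontr)
        assume "\<not> x \<le> z"
        then have "m z < m x" using up' xP by simp
        moreover have "m z = m x" using that xS
          by (auto simp: fibre_def f_def cap_label_def split: if_splits)
        ultimately show False by simp
      qed
      note cp = nc_perm_pred[OF w(1) xn]
      have max: "z \<le> w x" if "z \<in> fibre n f x" for z
        using cyclic_predD(3)[OF cp that] min[OF cyclic_predD(2)[OF cp]] by linarith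
      have "0 < card (P \<inter> {..x})" using xP fin by (auto simp: card_gt_0_iff)
      moreover have "card (P \<inter> {..x}) \<le> card Q" unfolding cardPQ[symmetric]
        using fin by (intro card_mono) auto
      ultimately obtain q where q: "q \<in> Q" "card (Q \<inter> {q..}) = card (P \<inter> {..x})"
        using ex_rank[OF fin(2), of "card (P \<inter> {..x})"] by auto
      have qr: "r < q" "q \<in> {1..n}" using q A by (auto simp: Q_def)
      then have "m q = m x" using q x by (simp add: m_def)
      moreover have "q \<notin> S" using qr by (simp add: S_def)
      ultimately have "q \<in> fibre n f x" using qr xS by (simp add: fibre_def f_def cap_label_def)
      then have "q \<le> w x" using max by simp
      moreover have "\<not> q < w x"
      proof
        assume "q < w x"
        then have "m (w x) < m q" using down' q by simp
        moreover have "m (w x) = m x" using lw(2) xS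
          by (auto simp: f_def cap_label_def split: if_splits)
        ultimately show False using \<open>m q = m x\<close> by simp
      qed
      ultimately show ?thesis using q by (simp add: Q_def)
    qed
  qed
  have wr: "w ` {1..r} = A"
  proof (rule card_subset_eq[OF finA])
    show "w ` {1..r} \<subseteq> A" using wA by blast
    show "card (w ` {1..r}) = card A"
      using NC_permutes[OF w(2)] A(2) by (subst card_image) (auto simp: permutes_inj_on)
  qed
  have "Transposition.transpose i j \<circ> w \<in> NC n"
    if inv: "(i, j) \<in> Inv n A" and qa: "quasi_arc r A i j" for i j
  proof -
    have ij: "i \<in> {1..n}" "i \<notin> A" "j \<in> A" "i < j" "j \<in> {1..n}"
      using inv A by (auto simp: Inv_def)
    have iS: "i \<notin> S" using ij by (simp add: S_def)
    let ?c = "card (A \<inter> {i<..<j})"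
    have c: "?c \<le> min r j - i" "min r j - i \<le> Suc ?c" using qa by (auto simp: quasi_arc_def)
    have split: ?thesis if "m i = m j" "j \<notin> S"
    proof -
      have "f i = f j" using that iS by (simp add: f_def cap_label_def)
      then show ?thesis using nc_perm_in_NC[OF nc_perm_split[OF w(1) ij(1,5) _ ij(4)]] by simp
    qed
    consider "j \<le> r" | "r < i" | "i \<le> r" "r < j" by linarith
    then show ?thesis
    proof cases
      case 1
      \<comment> \<open>Now \<open>min r j = j\<close>, and the arc condition leaves no room for an
        element outside \<open>A\<close> strictly between \<open>i\<close> and
        \<open>j\<close>.\<close>
      have "A \<inter> {i<..<j} = {i<..<j}"
      proof (intro card_subset_eq)
        have "card (A \<inter> {i<..<j}) \<le> card {i<..<j}" by (intro card_mono) auto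
        then show "card (A \<inter> {i<..<j}) = card {i<..<j}" using 1 c by simp
      qed auto
      then have sub: "{i<..j} \<subseteq> A" using ij by force
      have "P \<inter> {..j} = P \<inter> {..i}" 
      proof -
        have "x \<le> j \<longleftrightarrow> x \<le> i" if "x \<in> P" for x
          using sub ij that by (cases "x \<le> i") (auto simp: P_def subset_iff)
        then show ?thesis by blast
      qed
      then have mij: "m i = m j" using 1 ij by (simp add: m_def)
      \<comment> \<open>The singleton \<open>j\<close> is released and joins the block of
        \<open>i\<close>, which has the same height. By \<open>T\<close> it is the only element of
        that block in \<open>(i, j]\<close>, so the cut restores \<open>f\<close>.\<close>
      let ?g = "cap_label (S - {j}) m"
      have T: "?g x = ?g i \<and> x \<in> {i<..j} \<longleftrightarrow> x = j" for x
        using sub iS mij ij 1 by (auto simp: cap_label_def S_def)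
      show ?thesis
      proof (rule nc_perm_merge[OF w(1) nc_label_cap_label[OF up down] ij(1,5,4)])
        show "?g i = ?g j" using iS mij by (simp add: cap_label_def)
        fix x y assume "x \<in> {1..n}" "y \<in> {1..n}"
        show "f x = f y \<longleftrightarrow>
          ?g x = ?g y \<and> (?g x = ?g i \<and> x \<in> {i<..j}) = (?g y = ?g i \<and> y \<in> {i<..j})"
          unfolding T using ij 1 by (auto simp: f_def cap_label_def S_def)
      qed
    next
      case 2
      \<comment> \<open>For \<open>r < i\<close> the truncated difference \<open>min r j - i\<close>
        is 0.\<close>
      then have "A \<inter> {i<..<j} = {}" using c finA by simp
      then have "i \<le> x \<longleftrightarrow> j \<le> x" if "x \<in> Q" for x
        using ij that by (cases "j \<le> x"; cases "x = i") (auto simp: Q_def)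
      then have "Q \<inter> {i..} = Q \<inter> {j..}" by blast
      then have "m i = m j" using 2 ij by (simp add: m_def)
      then show ?thesis using split 2 ij by (simp add: S_def)
    next
      case 3
      have iP: "i \<in> P" and jQ: "j \<in> Q" using 3 ij by (auto simp: P_def Q_def)
      have jS: "j \<notin> S" using 3 by (simp add: S_def)
      \<comment> \<open>By \<open>e1\<close> and \<open>e2\<close>, \<open>m j - m i\<close> is the
        number of elements of \<open>P\<close> in \<open>(i, r]\<close> minus the number of elements
        of \<open>Q\<close> in \<open>(r, j)\<close>. The elements of \<open>A\<close> in
        \<open>(i, r]\<close> cancel from the arc condition, which then says that this difference is
        0 or 1.\<close>
      have e1: "card P = m i + card (P \<inter> {i<..r})"
      proof -
        have "P = (P \<inter> {..i}) \<union> (P \<inter> {i<..r})" by (auto simp: P_def)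
        then have "card P = card (P \<inter> {..i}) + card (P \<inter> {i<..r})"
          using fin by (subst card_Un_disjoint[symmetric]) auto
        then show ?thesis using 3 by (simp add: m_def)
      qed
      have e2: "card Q = m j + card (Q \<inter> {r<..<j})"
      proof -
        have "Q = (Q \<inter> {j..}) \<union> (Q \<inter> {r<..<j})" using A by (auto simp: Q_def)
        then have "card Q = card (Q \<inter> {j..}) + card (Q \<inter> {r<..<j})"
          using fin by (subst card_Un_disjoint[symmetric]) auto
        then show ?thesis using 3 by (simp add: m_def)
      qed
      have e3: "?c = card (A \<inter> {i<..r}) + card (Q \<inter> {r<..<j})"
      proof -
        have "A \<inter> {i<..<j} = (A \<inter> {i<..r}) \<union> (Q \<inter> {r<..<j})" using 3 by (auto simp: Q_def)
        then show ?thesis using fin finA by (simp only:) (intro card_Un_disjoint, auto)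
      qed
      have e4: "r - i = card (A \<inter> {i<..r}) + card (P \<inter> {i<..r})"
      proof -
        have "{i<..r} = (A \<inter> {i<..r}) \<union> (P \<inter> {i<..r})" by (auto simp: P_def)
        then have "card {i<..r} = card (A \<inter> {i<..r}) + card (P \<inter> {i<..r})"
          using fin finA by (subst card_Un_disjoint[symmetric]) (auto simp: P_def)
        then show ?thesis by simp
      qed
      have "min r j = r" using 3 by simp
      then have "m j = m i \<or> m j = Suc (m i)" using c e1 e2 e3 e4 cardPQ by linarith
      then show ?thesis
      proof
        assume "m j = m i"
        then show ?thesis using split jS by simp
      next
        assume mj: "m j = Suc (m i)"
        \<comment> \<open>Identifying two consecutive levels keeps the heights monotone on both
          sides of \<open>r\<close>. By \<open>T\<close>, outside \<open>S\<close> the level of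
          \<open>j\<close> lies within \<open>(i, j]\<close> and the level of \<open>i\<close>
          avoids it, so the cut recovers the two levels.\<close>
        define m' where "m' x = (if m x = m j then m i else m x)" for x
        let ?g = "cap_label S m'"
        have up'': "m' x \<le> m' y" if "x \<le> y" "y \<le> r" for x y
          using up[OF that] mj by (auto simp: m'_def)
        have down'': "m' y \<le> m' x" if "r < x" "x \<le> y" for x y
          using down[OF that] mj by (auto simp: m'_def)
        have T: "?g x = ?g i \<and> x \<in> {i<..j} \<longleftrightarrow> x \<notin> S \<and> m x = m j" if x: "x \<in> {1..n}" for x
        proof (cases "x \<in> S")
          case True
          then show ?thesis using iS by (simp add: cap_label_def)
        next
          case False
          then have xP: "x \<in> P" if "x \<le> r" using that x by (auto simp: P_def S_def)
          have "i < x \<and> x \<le> j" if "m x = m j"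
          proof
            show "i < x" using up[of x i] that mj 3 by (cases "i < x") auto
            show "x \<le> j" using down'[OF _ jQ, of x] that by (cases "x \<le> j") auto
          qed
          moreover have "m x \<noteq> m i" if "i < x" "x \<le> j"
          proof (cases "x \<le> r")
            case True
            then show ?thesis using up'[OF that(1) xP] by simp
          next
            case False
            then show ?thesis using down[of x j] that mj by simp
          qed
          ultimately show ?thesis using False iS by (auto simp: cap_label_def m'_def)
        qed
        show ?thesis
        proof (rule nc_perm_merge[OF w(1) nc_label_cap_label[OF up'' down''] ij(1,5,4)])
          show "?g i = ?g j" using iS jS by (simp add: cap_label_def m'_def)
          fix x y assume xy: "x \<in> {1..n}" "y \<in> {1..n}"
          show "f x = f y \<longleftrightarrow>
            ?g x = ?g y \<and> (?g x = ?g i \<and> x \<in> {i<..j}) = (?g y = ?g i \<and> y \<in> {i<..j})"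
            unfolding T[OF xy(1)] T[OF xy(2)] by (auto simp: f_def cap_label_def m'_def)
        qed
      qed
    qed
  qed
  then show ?thesis using that w(2) wr by blast
qed

section \<open>Spans of matrix columns\<close>

lemma pos_less:
  assumes "finite A" "j < j'" "j' \<in> A"
  shows "pos A j < pos A j'"
proof -
  have "j' \<in> {a \<in> A. a \<le> j'} - {a \<in> A. a \<le> j}" "{a \<in> A. a \<le> j} \<subseteq> {a \<in> A. a \<le> j'}"
    using assms by auto
  then have "{a \<in> A. a \<le> j} \<subset> {a \<in> A. a \<le> j'}" by blast
  then show ?thesis unfolding pos_def using assms(1) by (intro psubset_card_mono) auto
qed

lemma bij_betw_pos:
  assumes "finite A"
  shows "bij_betw (pos A) A {1..card A}"
  unfolding bij_betw_def
proof
  show inj: "inj_on (pos A) A"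
  proof (rule inj_onI)
    fix x y assume *: "x \<in> A" "y \<in> A" "pos A x = pos A y"
    then show "x = y"
      using pos_less[OF assms, of x y] pos_less[OF assms, of y x]
      by (cases x y rule: linorder_cases) auto
  qed
  have "pos A x \<in> {1..card A}" if "x \<in> A" for x
  proof -
    have "{a \<in> A. a \<le> x} \<noteq> {}" using that by blast
    then have "0 < pos A x" using assms by (simp add: pos_def card_gt_0_iff)
    moreover have "pos A x \<le> card A" unfolding pos_def using assms by (intro card_mono) auto
    ultimately show ?thesis by simp
  qed
  then have "pos A ` A \<subseteq> {1..card A}" by blast
  then show "pos A ` A = {1..card A}"
    using card_image[OF inj] by (intro card_subset_eq) auto
qed

lemma inv_into_pos: "finite A \<Longrightarrow> j \<in> A \<Longrightarrow> inv_into A (pos A) (pos A j) = j"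
  using bij_betw_pos[of A] by (simp add: bij_betw_def)

lemma subsetsD: "A \<in> subsets r n \<Longrightarrow> A \<subseteq> {1..n} \<and> finite A \<and> card A = r"
  unfolding subsets_def using finite_subset by blast

lemma colspan_pos:
  assumes "finite A" "card A = r"
  shows "colspan r M = cvs.span ((\<lambda>j i. M i (pos A j)) ` A)"
proof -
  have "{1..r} = pos A ` A" using bij_betw_pos[OF assms(1)] assms(2) by (simp add: bij_betw_def)
  then show ?thesis unfolding colspan_def by (simp add: image_image)
qed

lemma span_image_eqI:
  assumes "\<And>k. k \<in> K \<Longrightarrow> f k \<in> cvs.span (g ` K)" "\<And>k. k \<in> K \<Longrightarrow> g k \<in> cvs.span (f ` K)"
  shows "cvs.span (f ` K) = cvs.span (g ` K)"
  unfolding cvs.span_eq using assms by blast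

lemma sum_vscale_apply: "(\<Sum>i\<in>I. vscale (c i) (f i)) x = (\<Sum>i\<in>I. c i * f i x)"
  by (induction I rule: infinite_finite_induct) (simp_all add: vscale_def)

text \<open>Scaling the rows changes the pivot of column \<open>j\<close> into \<open>t j\<close>;
  dividing the column by \<open>t j\<close> restores it and leaves the span unchanged.\<close>

lemma colspan_torus:
  assumes "finite A" "card A = r" "\<And>j. j \<in> A \<Longrightarrow> t j \<noteq> 0"
    and N: "\<And>i j. j \<in> A \<Longrightarrow> N i (pos A j) * t j = t i * M i (pos A j)"
  shows "torus_act t (colspan r M) = colspan r N"
proof -
  let ?T = "\<lambda>v i. t i * v i :: complex"
  interpret l: Vector_Spaces.linear vscale vscale ?T
    by unfold_locales (simp_all add: vscale_def fun_eq_iff algebra_simps)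
  have "torus_act t (colspan r M) = cvs.span (?T ` (\<lambda>j i. M i (pos A j)) ` A)"
    unfolding torus_act_def colspan_pos[OF assms(1,2)] l.span_image ..
  also have "\<dots> = cvs.span ((\<lambda>j i. t i * M i (pos A j)) ` A)" by (simp only: image_image)
  also have "\<dots> = cvs.span ((\<lambda>j i. N i (pos A j)) ` A)"
  proof (rule span_image_eqI)
    fix j assume j: "j \<in> A"
    have 1: "(\<lambda>i. t i * M i (pos A j)) = vscale (t j) (\<lambda>i. N i (pos A j))"
      using N[OF j] by (simp add: vscale_def fun_eq_iff mult.commute)
    then show "(\<lambda>i. t i * M i (pos A j)) \<in> cvs.span ((\<lambda>j i. N i (pos A j)) ` A)"
      using j by (simp add: cvs.span_base cvs.span_scale)
    have "(\<lambda>i. N i (pos A j)) = vscale (inverse (t j)) (\<lambda>i. t i * M i (pos A j))"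
      unfolding 1 using assms(3)[OF j] by (simp add: vscale_def fun_eq_iff)
    moreover have "(\<lambda>i. t i * M i (pos A j)) \<in> cvs.span ((\<lambda>j i. t i * M i (pos A j)) ` A)"
      using j by (simp add: cvs.span_base)
    ultimately show "(\<lambda>i. N i (pos A j)) \<in> cvs.span ((\<lambda>j i. t i * M i (pos A j)) ` A)"
      by (simp only: cvs.span_scale)
  qed
  finally show ?thesis unfolding colspan_pos[OF assms(1,2)] .
qed

section \<open>The cells of the quasisymmetric Grassmannian\<close>

text \<open>Column reduction in one round: the entry of column \<open>j\<close> in another pivot row
  \<open>i\<close> is cleared by subtracting a multiple of the column of \<open>i\<close>. The
  columns used are unit vectors, so the subtraction touches nothing else.\<close>

lemma colspan_pivots:
  assumes w: "inj w" "w ` {1..r} = A" and A: "finite A" "card A = r"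
    and N: "\<And>i j. j \<in> A \<Longrightarrow> N i (pos A j) = (if i \<in> A \<and> i \<noteq> j then 0 else M i (inv_into UNIV w j))"
    and unit: "\<And>i j. \<lbrakk>i \<in> A; j \<in> A; i \<noteq> j; M i (inv_into UNIV w j) \<noteq> 0\<rbrakk> \<Longrightarrow>
      (\<lambda>x. M x (inv_into UNIV w i)) = (\<lambda>x. if x = i then 1 else 0)"
  shows "colspan r M = colspan r N"
proof -
  let ?m = "\<lambda>j x. M x (inv_into UNIV w j)" and ?n = "\<lambda>j x. N x (pos A j)"
  have "inv_into UNIV w ` A = {1..r}" using w by (auto simp: image_iff)
  then have "colspan r M = cvs.span (?m ` A)" unfolding colspan_def by (metis image_image)
  also have "\<dots> = cvs.span (?n ` A)"
  proof (rule span_image_eqI)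
    fix j assume j: "j \<in> A"
    let ?I = "{i \<in> A. i \<noteq> j \<and> M i (inv_into UNIV w j) \<noteq> 0}"
    have unit_n: "?n i = ?m i" if "i \<in> ?I" for i
    proof -
      have i: "i \<in> A" using that by simp
      have "?m i = (\<lambda>x. if x = i then 1 else 0)" using unit[of i j] that j by simp
      then show ?thesis using N[OF i] by (auto simp: fun_eq_iff)
    qed
    have eq: "?m j = ?n j + (\<Sum>i\<in>?I. vscale (M i (inv_into UNIV w j)) (?m i))"
    proof
      fix x
      have "(\<Sum>i\<in>?I. vscale (M i (inv_into UNIV w j)) (?m i)) x
          = (\<Sum>i\<in>?I. M i (inv_into UNIV w j) * ?m i x)" by (rule sum_vscale_apply)
      also have "\<dots> = (\<Sum>i\<in>?I. if x = i then M i (inv_into UNIV w j) else 0)"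
      proof (rule sum.cong[OF refl])
        fix i assume "i \<in> ?I"
        then have "?m i = (\<lambda>x. if x = i then 1 else 0)" using unit[of i j] j by simp
        then have "?m i x = (if x = i then 1 else 0)" by (rule fun_cong)
        then show "M i (inv_into UNIV w j) * ?m i x = (if x = i then M i (inv_into UNIV w j) else 0)"
          by simp
      qed
      also have "\<dots> = (if x \<in> ?I then M x (inv_into UNIV w j) else 0)"
        using A(1) by (subst sum.delta') auto
      finally show "?m j x = (?n j + (\<Sum>i\<in>?I. vscale (M i (inv_into UNIV w j)) (?m i))) x"
        using N[OF j, of x] by auto
    qed
    have "(\<Sum>i\<in>?I. vscale (M i (inv_into UNIV w j)) (?m i)) \<in> cvs.span (?m ` A)"
      by (intro cvs.span_sum cvs.span_scale cvs.span_base) auto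
    moreover have "?n j = ?m j - (\<Sum>i\<in>?I. vscale (M i (inv_into UNIV w j)) (?m i))"
      using eq by (simp add: algebra_simps)
    moreover have "?m j \<in> cvs.span (?m ` A)" using j by (intro cvs.span_base) auto
    ultimately show "?n j \<in> cvs.span (?m ` A)" by (simp only: cvs.span_diff)
    have "(\<Sum>i\<in>?I. vscale (M i (inv_into UNIV w j)) (?m i)) \<in> cvs.span (?n ` A)"
    proof (intro cvs.span_sum cvs.span_scale)
      fix i assume i: "i \<in> ?I"
      then have "?n i \<in> cvs.span (?n ` A)" by (intro cvs.span_base) auto
      then show "?m i \<in> cvs.span (?n ` A)" using unit_n[OF i] by simp
    qed
    moreover have "?n j \<in> cvs.span (?n ` A)" using j by (intro cvs.span_base) auto
    ultimately show "?m j \<in> cvs.span (?n ` A)" using eq by (simp only: cvs.span_add)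
  qed
  finally show ?thesis unfolding colspan_pos[OF A] .
qed

lemma cell_mats_pivot:
  assumes "M \<in> cell_mats n A" "i \<in> A" "j \<in> A" "A \<subseteq> {1..n}"
  shows "M i (pos A j) = (if i = j then 1 else 0)"
proof -
  have "(i, j) \<notin> Inv n A" "i \<in> {1..n}" using assms by (auto simp: Inv_def)
  then show ?thesis using assms(1,3) unfolding cell_mats_def by auto
qed

lemma NC_cell_mats_zero:
  assumes "M \<in> NC_cell_mats r n A" "i \<noteq> j" "j \<in> A" "(i, j) \<notin> InvQ r n A"
  shows "M i (pos A j) = 0"
proof (cases "i \<in> {1..n}")
  case True
  then show ?thesis using assms unfolding NC_cell_mats_def cell_mats_def
    by (cases "(i, j) \<in> Inv n A") auto
next
  case False
  then show ?thesis using assms unfolding NC_cell_mats_def cell_mats_def mats_def by auto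
qed

lemma NC_cell_matsI:
  assumes "A \<in> subsets r n" "M \<in> mats n r" "\<And>j. j \<in> A \<Longrightarrow> M j (pos A j) = 1"
    and "\<And>i j. j \<in> A \<Longrightarrow> i \<noteq> j \<Longrightarrow> (i, j) \<notin> InvQ r n A \<Longrightarrow> M i (pos A j) = 0"
  shows "M \<in> NC_cell_mats r n A"
proof -
  have "InvQ r n A \<subseteq> Inv n A" by (auto simp: InvQ_def)
  moreover have "i \<noteq> j \<and> j \<in> A" if "(i, j) \<in> Inv n A" for i j using that by (auto simp: Inv_def)
  ultimately show ?thesis
    using assms subsetsD[OF assms(1)] unfolding NC_cell_mats_def cell_mats_def by blast
qed

text \<open>With \<open>A = w [r]\<close>, the first \<open>r\<close> columns fail to lie in the
  cell of \<open>A\<close> only through nonzero entries in other pivot rows. These can be cleared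
  without changing the span; any other nonzero entry off the pivots is at an arc, witnessed by
  \<open>w\<close> itself.\<close>

lemma QFl_cell_subset:
  assumes w: "w \<in> NC n" and r: "r \<le> n" and M: "M \<in> mats n n" "\<forall>j\<in>{1..n}. M (w j) j = 1"
    "\<forall>i\<in>{1..n}. \<forall>j\<in>{1..n}. i \<noteq> w j \<and> (i, j) \<notin> QFl_positions n w \<longrightarrow> M i j = 0"
  shows "\<exists>A\<in>subsets r n. colspan r M \<in> colspan r ` NC_cell_mats r n A"
proof -
  have wp: "w permutes {1..n}" using NC_permutes[OF w] .
  have inj: "inj w" and bij: "bij w" using wp permutes_inj permutes_bij by blast+
  define A where "A = w ` {1..r}"
  have A: "finite A" "card A = r" "A \<subseteq> {1..n}"
    using r permutes_in_image[OF wp] inj by (auto simp: A_def card_image inj_on_def)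
  then have As: "A \<in> subsets r n" by (simp add: subsets_def)
  have winv: "inv_into UNIV w j \<in> {1..n}" "w (inv_into UNIV w j) = j" if "j \<in> {1..n}" for j
    using that permutes_inverses(1)[OF wp] permutes_in_image[OF permutes_inv[OF wp]] by auto
  have pos: "i < j \<and> inv_into UNIV w j < inv_into UNIV w i \<and> Transposition.transpose i j \<circ> w \<in> NC n"
    if "i \<noteq> j" "j \<in> {1..n}" "M i (inv_into UNIV w j) \<noteq> 0" for i j
  proof -
    have i: "i \<in> {1..n}" using M(1) that(3) by (auto simp: mats_def)
    have "(i, inv_into UNIV w j) \<in> QFl_positions n w"
      using M(3)[rule_format, OF i winv(1)[OF that(2)]] winv(2)[OF that(2)] that(1,3) by metis
    then obtain j' where j': "inv_into UNIV w j = inv_into UNIV w j'" "i < j'" "j' \<in> {1..n}"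
      "inv_into UNIV w j' < inv_into UNIV w i" "Transposition.transpose i j' \<circ> w \<in> NC n"
      unfolding QFl_positions_def by blast
    then have "j' = j" using winv(2) that(2) by metis
    then show ?thesis using j' by simp
  qed
  \<comment> \<open>Besides clearing the pivot rows, \<open>N\<close> reorders the columns:
    \<open>w\<close> may list \<open>A\<close> in any order, whereas \<open>pos A\<close> follows
    the increasing one.\<close>
  define N where "N i k = (if k \<in> {1..r} then
    (let j = inv_into A (pos A) k in if i \<in> A \<and> i \<noteq> j then 0 else M i (inv_into UNIV w j)) else 0)" for i k
  have posr: "pos A j \<in> {1..r}" if "j \<in> A" for j
    using bij_betw_pos[OF A(1)] A(2) that by (auto simp: bij_betw_def)
  have N: "N i (pos A j) = (if i \<in> A \<and> i \<noteq> j then 0 else M i (inv_into UNIV w j))" if "j \<in> A" for i j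
    using posr[OF that] inv_into_pos[OF A(1) that] by (simp add: N_def Let_def)
  have "N \<in> NC_cell_mats r n A"
  proof (rule NC_cell_matsI[OF As])
    show "N \<in> mats n r"
    proof -
      have "N i k = 0" if "i \<notin> {1..n} \<or> k \<notin> {1..r}" for i k
        using that M(1) by (auto simp: N_def mats_def Let_def)
      then show ?thesis unfolding mats_def by blast
    qed
    show "N j (pos A j) = 1" if j: "j \<in> A" for j
    proof -
      have "j \<in> {1..n}" using j A by blast
      then show ?thesis using N[OF j] M(2) winv by metis
    qed
    fix i j assume ij: "j \<in> A" "i \<noteq> j" "(i, j) \<notin> InvQ r n A"
    show "N i (pos A j) = 0"
    proof (rule ccontr)
      assume "N i (pos A j) \<noteq> 0"
      then have *: "i \<notin> A" "M i (inv_into UNIV w j) \<noteq> 0" using N[OF ij(1)] ij(2) by (auto split: if_splits)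
      have "j \<in> {1..n}" using ij A by blast
      note p = pos[OF ij(2) this *(2)]
      have "i \<in> {1..n}" using M(1) *(2) by (auto simp: mats_def)
      then have "(i, j) \<in> Inv n A" using p ij(1) *(1) by (simp add: Inv_def)
      then show False using InvQ_I[OF w A_def[symmetric] As] p ij(3) by blast
    qed
  qed
  moreover have "colspan r M = colspan r N"
  proof (rule colspan_pivots[OF inj A_def[symmetric] A(1,2) N])
    fix i j assume ij: "i \<in> A" "j \<in> A" "i \<noteq> j" "M i (inv_into UNIV w j) \<noteq> 0"
    have ijn: "i \<in> {1..n}" "j \<in> {1..n}" using ij A by auto
    note p = pos[OF ij(3) ijn(2) ij(4)]
    \<comment> \<open>The nonzero entry in row \<open>i\<close> forces
      \<open>i < inv_into UNIV w i\<close>; a nonzero entry off the pivot in the column of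
      \<open>i\<close> would force the opposite inequality.\<close>
    have "i < inv_into UNIV w i" using NC_inversion_bounds(2)[OF w _ ijn] p by blast
    have "M x (inv_into UNIV w i) = 0" if "x \<noteq> i" for x
    proof (rule ccontr)
      assume *: "M x (inv_into UNIV w i) \<noteq> 0"
      have "x \<in> {1..n}" using M(1) * by (auto simp: mats_def)
      then have "inv_into UNIV w i \<le> i"
        using NC_inversion_bounds(1)[OF w _ _ ijn(1)] pos[OF that ijn(1) *] by blast
      then show False using \<open>i < inv_into UNIV w i\<close> by simp
    qed
    moreover have "M i (inv_into UNIV w i) = 1" using M(2) winv[OF ijn(1)] by metis
    ultimately show "(\<lambda>x. M x (inv_into UNIV w i)) = (\<lambda>x. if x = i then 1 else 0)" by auto
  qed
  ultimately show ?thesis using As by blast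
qed

text \<open>All coordinates of the cell may be nonzero at once, so one permutation has to realize
  every arc. The flag matrix takes the columns of \<open>M\<close> in the order given by
  \<open>w\<close> and completes them by unit vectors.\<close>

lemma NC_cell_subset:
  assumes A: "A \<in> subsets r n" and r: "r \<le> n" and M: "M \<in> NC_cell_mats r n A"
  shows "colspan r M \<in> QGr r n"
proof -
  note A' = subsetsD[OF A]
  obtain w where w: "w \<in> NC n" "w ` {1..r} = A"
    "\<And>i j. (i, j) \<in> Inv n A \<Longrightarrow> quasi_arc r A i j \<Longrightarrow> Transposition.transpose i j \<circ> w \<in> NC n"
    using NC_representative[OF A r] by metis
  have wp: "w permutes {1..n}" using NC_permutes[OF w(1)] .
  have inj: "inj w" using wp permutes_inj by blast
  have winv: "inv_into UNIV w (w j) = j" for j using inj by simp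
  have wA: "w k \<in> A \<longleftrightarrow> k \<in> {1..r}" for k 
    using inj_image_mem_iff[OF inj, of k "{1..r}"] w(2) by simp
  define N where "N i k = (if k \<in> {1..r} then M i (pos A (w k))
    else if k \<in> {1..n} \<and> i = w k then 1 else 0)" for i k
  have M0: "M i k = 0" if "i \<notin> {1..n}" for i k
    using M that unfolding NC_cell_mats_def cell_mats_def mats_def by auto
  have Nm: "N \<in> mats n n"
  proof -
    have "N i k = 0" if "i \<notin> {1..n} \<or> k \<notin> {1..n}" for i k
      using that M0 r permutes_in_image[OF wp, of k] by (auto simp: N_def)
    then show ?thesis unfolding mats_def by blast
  qed
  have "N (w j) j = 1" if "j \<in> {1..n}" for j
    using that wA[of j] M unfolding NC_cell_mats_def cell_mats_def N_def by auto
  moreover have "N i j = 0"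
    if "i \<in> {1..n}" "j \<in> {1..n}" "i \<noteq> w j" "(i, j) \<notin> QFl_positions n w" for i j
  proof (rule ccontr)
    assume "N i j \<noteq> 0"
    then have j: "j \<in> {1..r}" "M i (pos A (w j)) \<noteq> 0" using that by (auto simp: N_def split: if_splits)
    then have "(i, w j) \<in> InvQ r n A" using NC_cell_mats_zero[OF M that(3)] wA by blast
    then have inv: "(i, w j) \<in> Inv n A" and "Transposition.transpose i (w j) \<circ> w \<in> NC n"
      using w(3) InvQ_quasi_arc A' by (auto simp: InvQ_def)
    \<comment> \<open>\<open>w\<close> maps \<open>[r]\<close> onto \<open>A\<close>, so the
      preimage of \<open>i\<close>, which is not in \<open>A\<close>, exceeds \<open>r\<close>,
      while \<open>j\<close> is a position in \<open>[r]\<close>. Every arc is therefore an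
      inversion of \<open>w\<close>.\<close>
    moreover have "j < inv_into UNIV w i"
    proof -
      have "inv_into UNIV w i \<notin> {1..r}"
        using wA[of "inv_into UNIV w i"] inv permutes_inverses(1)[OF wp] by (simp add: Inv_def)
      moreover have "inv_into UNIV w i \<in> {1..n}"
        using that(1) permutes_in_image[OF permutes_inv[OF wp]] by simp
      ultimately show ?thesis using j(1) by auto
    qed
    moreover have "w j \<in> {1..n}" using that(2) permutes_in_image[OF wp] by simp
    ultimately have "(i, inv_into UNIV w (w j)) \<in> QFl_positions n w"
      unfolding QFl_positions_def mem_Collect_eq using that(1)
      by (intro exI[of _ i] exI[of _ "w j"]) (simp add: Inv_def winv)
    then show False using that(4) by (simp add: winv)
  qed
  ultimately have "flag_of N \<in> QFl_cell n w" using Nm unfolding QFl_cell_def by blast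
  then have "flag_of N r \<in> QGr r n" using w(1) unfolding QGr_def QFl_def by blast
  moreover have "flag_of N r = colspan r M"
  proof -
    have "(\<lambda>k i. N i k) ` {1..r} = (\<lambda>k i. M i (pos A (w k))) ` {1..r}"
      by (intro image_cong) (auto simp: N_def)
    also have "\<dots> = (\<lambda>j i. M i (pos A j)) ` A" unfolding w(2)[symmetric] by (simp add: image_image)
    finally show ?thesis
      unfolding flag_of_def colspan_def[of r N] colspan_pos[OF A'[THEN conjunct2, THEN conjunct1]
        A'[THEN conjunct2, THEN conjunct2], of M] by simp
  qed
  ultimately show ?thesis by simp
qed

lemma QGr_eq:
  assumes "r \<le> n"
  shows "QGr r n = (\<Union>A\<in>subsets r n. colspan r ` NC_cell_mats r n A)"
proof (intro equalityI subsetI)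
  fix V assume "V \<in> QGr r n"
  then obtain w M where w: "w \<in> NC n" and V: "V = colspan r M"
    and M: "M \<in> mats n n" "\<forall>j\<in>{1..n}. M (w j) j = 1"
      "\<forall>i\<in>{1..n}. \<forall>j\<in>{1..n}. i \<noteq> w j \<and> (i, j) \<notin> QFl_positions n w \<longrightarrow> M i j = 0"
    unfolding QGr_def QFl_def QFl_cell_def flag_of_def by blast
  show "V \<in> (\<Union>A\<in>subsets r n. colspan r ` NC_cell_mats r n A)"
    unfolding V using QFl_cell_subset[OF w assms M] by blast
qed (use NC_cell_subset assms in blast)

section \<open>Torus orbits\<close>

text \<open>No point is both a left and a right end; together with noncrossing this excludes cycles,
  so the values can be assigned edge by edge. Instead of building a forest, the induction removes a
  shortest arc and sets \<open>t\<close> last at an end that belongs to no other arc.\<close>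

lemma noncrossing_arcs_solvable:
  fixes c :: "nat \<times> nat \<Rightarrow> 'a :: field"
  assumes "finite F" and "\<And>i j. (i, j) \<in> F \<Longrightarrow> i < j"
    and "\<And>i j i' j'. (i, j) \<in> F \<Longrightarrow> (i', j') \<in> F \<Longrightarrow> i \<noteq> j'"
    and "\<And>i j i' j'. (i', j) \<in> F \<Longrightarrow> (i, j') \<in> F \<Longrightarrow> \<not> (i' < i \<and> i < j \<and> j < j')"
    and "\<And>e. e \<in> F \<Longrightarrow> c e \<noteq> 0"
  shows "\<exists>t. (\<forall>x. t x \<noteq> 0) \<and> (\<forall>(i, j)\<in>F. t i = c (i, j) * t j)"
  using assms
proof (induction "card F" arbitrary: F)
  case 0
  then have "F = {}" using card_0_eq[OF 0(2)] by simp
  then show ?case by (intro exI[of _ "\<lambda>_. 1"]) simp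
next
  case (Suc k)
  have ne: "F \<noteq> {}" using Suc.hyps(2) by force
  let ?len = "\<lambda>e. snd e - fst e"
  define e where "e = arg_min_on ?len F"
  have e: "e \<in> F" "?len e \<le> ?len e'" if "e' \<in> F" for e'
    unfolding e_def using arg_min_if_finite(1)[OF Suc.prems(1) ne, of ?len]
      arg_min_least[OF Suc.prems(1) ne that, of ?len] by blast+
  have "e \<in> F" using e(1) ne by blast
  obtain i j where ij: "e = (i, j)" by (rule prod.exhaust)
  have eF: "(i, j) \<in> F" using \<open>e \<in> F\<close> ij by simp
  have "i < j" using Suc.prems(2) eF .
  define G where "G = F - {(i, j)}"
  have "k = card G" using Suc.hyps(2) Suc.prems(1) eF by (simp add: G_def)
  moreover have "finite G" using Suc.prems(1) by (simp add: G_def)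
  ultimately have "\<exists>t. (\<forall>x. t x \<noteq> 0) \<and> (\<forall>(i, j)\<in>G. t i = c (i, j) * t j)"
  proof (rule Suc.hyps(1))
    show "a < b" if "(a, b) \<in> G" for a b using that Suc.prems(2) by (simp add: G_def)
    show "a \<noteq> d" if "(a, b) \<in> G" "(a', d) \<in> G" for a b a' d
      using that Suc.prems(3) by (auto simp: G_def)
    show "\<not> (a' < a \<and> a < b \<and> b < d)" if "(a', b) \<in> G" "(a, d) \<in> G" for a b a' d
      using that Suc.prems(4) by (auto simp: G_def)
    show "c e \<noteq> 0" if "e \<in> G" for e using that Suc.prems(5) by (simp add: G_def)
  qed
  then obtain t where t: "\<And>x. t x \<noteq> 0" "\<And>a b. (a, b) \<in> G \<Longrightarrow> t a = c (a, b) * t b" by blast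
  have c0: "c (i, j) \<noteq> 0" using Suc.prems(5) eF .
  \<comment> \<open>\<open>i\<close> is never a right end and \<open>j\<close> never a left end, so
    a new value at the leaf disturbs no other equation.\<close>
  have alt: "i \<noteq> b" "a \<noteq> j" if "(a, b) \<in> G" for a b
    using Suc.prems(3)[OF eF, of a b] Suc.prems(3)[of a b i j] eF that by (auto simp: G_def)
  \<comment> \<open>A shortest arc ends in a leaf: a longer arc at each end would give a crossing.\<close>
  have "(\<forall>a b. (a, b) \<in> G \<longrightarrow> a \<noteq> i) \<or> (\<forall>a b. (a, b) \<in> G \<longrightarrow> b \<noteq> j)"
  proof (rule ccontr)
    assume "\<not> ?thesis"
    then obtain a b where ab: "(i, b) \<in> G" "(a, j) \<in> G" by blast
    then have F: "(i, b) \<in> F" "(a, j) \<in> F" "b \<noteq> j" "a \<noteq> i" by (auto simp: G_def)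
    have "j - i \<le> b - i" "j - i \<le> j - a" using e(2)[OF F(1)] e(2)[OF F(2)] ij by auto
    then have "a < i" "j < b" using F(3,4) \<open>i < j\<close> Suc.prems(2)[OF F(2)] by auto
    then show False using Suc.prems(4)[OF F(2,1)] \<open>i < j\<close> by blast
  qed
  then show ?case
  proof
    assume leaf: "\<forall>a b. (a, b) \<in> G \<longrightarrow> a \<noteq> i"
    let ?t = "t(i := c (i, j) * t j)"
    have "?t a = c (a, b) * ?t b" if "(a, b) \<in> F" for a b
    proof (cases "(a, b) = (i, j)")
      case True then show ?thesis using \<open>i < j\<close> by simp
    next
      case False
      then have G: "(a, b) \<in> G" using that by (simp add: G_def)
      then show ?thesis using leaf alt(1)[OF G] t(2)[OF G] by auto
    qed
    then have "\<forall>(a, b)\<in>F. ?t a = c (a, b) * ?t b" by blast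
    moreover have "\<forall>x. ?t x \<noteq> 0" using t(1) c0 by simp
    ultimately show ?thesis by blast
  next
    assume leaf: "\<forall>a b. (a, b) \<in> G \<longrightarrow> b \<noteq> j"
    let ?t = "t(j := t i / c (i, j))"
    have "?t a = c (a, b) * ?t b" if "(a, b) \<in> F" for a b
    proof (cases "(a, b) = (i, j)")
      case True then show ?thesis using \<open>i < j\<close> c0 by simp
    next
      case False
      then have G: "(a, b) \<in> G" using that by (simp add: G_def)
      then show ?thesis using leaf alt(2)[OF G] t(2)[OF G] by auto
    qed
    then have "\<forall>(a, b)\<in>F. ?t a = c (a, b) * ?t b" by blast
    moreover have "\<forall>x. ?t x \<noteq> 0" using t(1) c0 by simp
    ultimately show ?thesis by blast
  qed
qed

text \<open>The common form to which torus orbits, \<open>orbit_cell\<close> and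
  \<open>positroid_cell\<close> are reduced; the support is a set of arcs rather than of
  boxes.\<close>

definition support_mats :: "nat \<Rightarrow> nat \<Rightarrow> nat set \<Rightarrow> (nat \<times> nat) set \<Rightarrow> (nat \<Rightarrow> nat \<Rightarrow> complex) set" where
  "support_mats r n A T =
     {M \<in> NC_cell_mats r n A. \<forall>(i, j)\<in>InvQ r n A. M i (pos A j) \<noteq> 0 \<longleftrightarrow> (i, j) \<in> T}"

lemma support_matsD:
  assumes "M \<in> support_mats r n A T" "A \<in> subsets r n"
  shows "M \<in> NC_cell_mats r n A" "\<And>j. j \<in> A \<Longrightarrow> M j (pos A j) = 1"
    "\<And>i j. j \<in> A \<Longrightarrow> i \<noteq> j \<Longrightarrow> (i, j) \<notin> InvQ r n A \<Longrightarrow> M i (pos A j) = 0"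
    "\<And>i j. (i, j) \<in> InvQ r n A \<Longrightarrow> M i (pos A j) \<noteq> 0 \<longleftrightarrow> (i, j) \<in> T"
proof -
  show 1: "M \<in> NC_cell_mats r n A" using assms by (simp add: support_mats_def)
  show "M j (pos A j) = 1" if "j \<in> A" for j
    using 1 that by (simp add: NC_cell_mats_def cell_mats_def)
  show "M i (pos A j) = 0" if "j \<in> A" "i \<noteq> j" "(i, j) \<notin> InvQ r n A" for i j
    using NC_cell_mats_zero[OF 1] that by blast
  show "M i (pos A j) \<noteq> 0 \<longleftrightarrow> (i, j) \<in> T" if "(i, j) \<in> InvQ r n A" for i j
    using assms that by (auto simp: support_mats_def)
qed

lemma torus_act_cell:
  assumes A: "A \<in> subsets r n" and M: "M \<in> support_mats r n A T" and t: "t \<in> torus n"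
  shows "\<exists>N\<in>support_mats r n A T. torus_act t (colspan r M) = colspan r N"
proof -
  note A' = subsetsD[OF A] and M' = support_matsD[OF M A]
  have t0: "t i \<noteq> 0" if "i \<in> {1..n}" for i using t that by (auto simp: torus_def)
  then have tA: "t j \<noteq> 0" if "j \<in> A" for j using that A' by blast
  define N where "N i k = t i * M i k / t (inv_into A (pos A) k)" for i k
  have N: "N i (pos A j) = t i * M i (pos A j) / t j" if "j \<in> A" for i j
    using inv_into_pos[of A j] that A' by (simp add: N_def)
  have "M \<in> mats n r" using M'(1) A' by (auto simp: NC_cell_mats_def cell_mats_def)
  then have "N \<in> mats n r" by (simp add: mats_def N_def)
  then have "N \<in> NC_cell_mats r n A"
    using M'(2,3) N tA by (intro NC_cell_matsI[OF A]) auto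
  moreover have "N i (pos A j) \<noteq> 0 \<longleftrightarrow> (i, j) \<in> T" if "(i, j) \<in> InvQ r n A" for i j
  proof -
    have "j \<in> A" "i \<in> {1..n}" using that by (auto simp: InvQ_def Inv_def)
    then show ?thesis using M'(4)[OF that] N t0 tA by auto
  qed
  ultimately have "N \<in> support_mats r n A T" by (auto simp: support_mats_def)
  moreover have "torus_act t (colspan r M) = colspan r N"
    using A' tA N by (intro colspan_torus) auto
  ultimately show ?thesis by blast
qed

lemma finite_InvQ: "A \<subseteq> {1..n} \<Longrightarrow> finite (InvQ r n A)"
  by (rule finite_subset[of _ "{1..n} \<times> {1..n}"]) (auto simp: InvQ_def Inv_def)

lemma torus_orbit_support:
  assumes A: "A \<in> subsets r n" and M: "M \<in> support_mats r n A T"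
  shows "torus_orbit n (colspan r M) = colspan r ` support_mats r n A T"
proof (intro equalityI subsetI)
  fix V assume "V \<in> torus_orbit n (colspan r M)"
  then show "V \<in> colspan r ` support_mats r n A T"
    using torus_act_cell[OF A M] by (auto simp: torus_orbit_def)
next
  fix V assume "V \<in> colspan r ` support_mats r n A T"
  then obtain N where N: "N \<in> support_mats r n A T" and V: "V = colspan r N" by blast
  note A' = subsetsD[OF A] and M' = support_matsD[OF M A] and N' = support_matsD[OF N A]
  let ?F = "InvQ r n A"
  \<comment> \<open>On arcs outside \<open>T\<close> both coordinates vanish and every factor is
    correct; 1 keeps \<open>c\<close> nonzero.\<close>
  define c where "c = (\<lambda>(i, j). if (i, j) \<in> T then N i (pos A j) / M i (pos A j) else 1)"
  have mem: "i \<notin> A \<and> j \<in> A \<and> i < j" if "(i, j) \<in> ?F" for i j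
    using that by (auto simp: InvQ_def Inv_def)
  have "\<exists>t. (\<forall>x. t x \<noteq> 0) \<and> (\<forall>(i, j)\<in>?F. t i = c (i, j) * t j)"
  proof (rule noncrossing_arcs_solvable)
    show "finite ?F" using finite_InvQ A' by blast
    show "i < j" if "(i, j) \<in> ?F" for i j using mem[OF that] by blast
    show "i \<noteq> j'" if "(i, j) \<in> ?F" "(i', j') \<in> ?F" for i j i' j'
      using mem[OF that(1)] mem[OF that(2)] by blast
    show "\<not> (i' < i \<and> i < j \<and> j < j')" if "(i', j) \<in> ?F" "(i, j') \<in> ?F" for i j i' j'
      using InvQ_noncrossing[OF that] A' by blast
    show "c e \<noteq> 0" if "e \<in> ?F" for e
      using that M'(4) N'(4) by (cases e) (auto simp: c_def)
  qed
  then obtain t where t: "\<And>x. t x \<noteq> 0" "\<And>i j. (i, j) \<in> ?F \<Longrightarrow> t i = c (i, j) * t j" by blast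
  \<comment> \<open>Elements of \<open>torus n\<close> are extensional; the rows outside
    \<open>{1..n}\<close> are zero in both matrices.\<close>
  let ?t = "restrict t {1..n}"
  have "?t \<in> torus n" using t(1) by (auto simp: torus_def)
  moreover have "torus_act ?t (colspan r M) = V"
    unfolding V
  proof (rule colspan_torus[of A])
    fix i j assume j: "j \<in> A"
    then have jn: "j \<in> {1..n}" using A' by blast
    show "N i (pos A j) * ?t j = ?t i * M i (pos A j)"
    proof (cases "(i, j) \<in> ?F")
      case True
      then have i: "i \<in> {1..n}" by (auto simp: InvQ_def Inv_def)
      have "N i (pos A j) = c (i, j) * M i (pos A j)"
        using M'(4)[OF True] N'(4)[OF True] by (cases "(i, j) \<in> T") (auto simp: c_def)
      then show ?thesis using t(2)[OF True] i jn by simp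
    next
      case False
      then show ?thesis using M'(2,3) N'(2,3) j by (cases "i = j") auto
    qed
  qed (use A' t(1) in auto)
  ultimately show "V \<in> torus_orbit n (colspan r M)" unfolding torus_orbit_def by blast
qed

lemma support_mats_nonempty:
  assumes A: "A \<in> subsets r n" and T: "T \<subseteq> InvQ r n A"
  shows "support_mats r n A T \<noteq> {}"
proof -
  note A' = subsetsD[OF A]
  define M where "M i k = (if k \<in> {1..r} \<and> (i = inv_into A (pos A) k \<or> (i, inv_into A (pos A) k) \<in> T)
    then 1 else 0 :: complex)" for i k
  have "pos A j \<in> {1..r}" if "j \<in> A" for j
    using bij_betw_pos[of A] A' that by (auto simp: bij_betw_def)
  then have M: "M i (pos A j) = (if i = j \<or> (i, j) \<in> T then 1 else 0)" if "j \<in> A" for i j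
    using inv_into_pos[of A j] that A' by (simp add: M_def)
  have "M i k = 0" if "i \<notin> {1..n} \<or> k \<notin> {1..r}" for i k
  proof (rule ccontr)
    assume "M i k \<noteq> 0"
    then have k: "k \<in> {1..r}" "i = inv_into A (pos A) k \<or> (i, inv_into A (pos A) k) \<in> T"
      by (auto simp: M_def split: if_splits)
    have "k \<in> pos A ` A" using k(1) bij_betw_pos[of A] A' by (simp add: bij_betw_def)
    then have "inv_into A (pos A) k \<in> A" by (rule inv_into_into)
    then have "i \<in> {1..n}" using k(2) T A' by (auto simp: InvQ_def Inv_def)
    then show False using that k(1) by simp
  qed
  then have "M \<in> mats n r" unfolding mats_def by blast
  then have "M \<in> NC_cell_mats r n A" using T M by (intro NC_cell_matsI[OF A]) auto
  moreover have "M i (pos A j) \<noteq> 0 \<longleftrightarrow> (i, j) \<in> T" if "(i, j) \<in> InvQ r n A" for i j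
  proof -
    have "j \<in> A" "i \<noteq> j" using that by (auto simp: InvQ_def Inv_def)
    then show ?thesis using M by simp
  qed
  ultimately show ?thesis unfolding support_mats_def by blast
qed

section \<open>Boxes and Le diagrams\<close>

lemma row_of_less:
  assumes "finite A" "j \<in> A" "j < j'"
  shows "row_of A j' < row_of A j"
proof -
  have "j \<in> {a \<in> A. j \<le> a} - {a \<in> A. j' \<le> a}" "{a \<in> A. j' \<le> a} \<subseteq> {a \<in> A. j \<le> a}"
    using assms by auto
  then have "{a \<in> A. j' \<le> a} \<subset> {a \<in> A. j \<le> a}" by blast
  then show ?thesis unfolding row_of_def using assms(1) by (intro psubset_card_mono) auto
qed

lemma col_of_less:
  assumes "i' \<in> {1..n} - A" "i < i'"
  shows "col_of n A i < col_of n A i'"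
proof -
  have "i' \<in> {e \<in> {1..n} - A. e \<le> i'} - {e \<in> {1..n} - A. e \<le> i}"
    "{e \<in> {1..n} - A. e \<le> i} \<subseteq> {e \<in> {1..n} - A. e \<le> i'}"
    using assms by auto
  then have "{e \<in> {1..n} - A. e \<le> i} \<subset> {e \<in> {1..n} - A. e \<le> i'}" by blast
  then show ?thesis unfolding col_of_def by (intro psubset_card_mono) auto
qed

lemma row_of_inject: "finite A \<Longrightarrow> j \<in> A \<Longrightarrow> j' \<in> A \<Longrightarrow> row_of A j = row_of A j' \<longleftrightarrow> j = j'"
  using row_of_less[of A j j'] row_of_less[of A j' j] by (cases j j' rule: linorder_cases) auto

lemma col_of_inject:
  "i \<in> {1..n} - A \<Longrightarrow> i' \<in> {1..n} - A \<Longrightarrow> col_of n A i = col_of n A i' \<longleftrightarrow> i = i'"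
  using col_of_less[of i' n A i] col_of_less[of i n A i'] by (cases i i' rule: linorder_cases) auto

lemma box_of_inject:
  assumes "finite A" "(i, j) \<in> Inv n A" "(i', j') \<in> Inv n A"
  shows "box_of n A (i, j) = box_of n A (i', j') \<longleftrightarrow> i = i' \<and> j = j'"
  using assms row_of_inject[of A j j'] col_of_inject[of i n A i'] by (auto simp: box_of_def Inv_def)

section \<open>Rows of the diagram and their lengths\<close>

lemma pos_sorted_list:
  assumes "finite A" "k < card A"
  shows "pos A (sorted_list_of_set A ! k) = Suc k"
proof -
  let ?s = "sorted_list_of_set A"
  have len: "length ?s = card A" and set: "set ?s = A" using assms(1) by auto
  have lt: "?s ! a < ?s ! b" if "a < b" "b < card A" for a b
    using that strict_sorted_list_of_set[of A] len sorted_wrt_nth_less by metis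
  have "{a \<in> A. a \<le> ?s ! k} = (!) ?s ` {..k}"
  proof (intro equalityI subsetI)
    fix a assume a: "a \<in> {a \<in> A. a \<le> ?s ! k}"
    then obtain l where l: "l < card A" "a = ?s ! l" using set len by (metis in_set_conv_nth mem_Collect_eq)
    then have "l \<le> k" using lt[of k l] a by (cases "l \<le> k") auto
    then show "a \<in> (!) ?s ` {..k}" using l by blast
  next
    fix a assume "a \<in> (!) ?s ` {..k}"
    then obtain l where l: "l \<le> k" "a = ?s ! l" by blast
    then have "a \<le> ?s ! k" using lt[of l k] assms(2) by (cases "l = k") auto
    moreover have "a \<in> A" using l assms(2) set len nth_mem[of l ?s] by simp
    ultimately show "a \<in> {a \<in> A. a \<le> ?s ! k}" by simp
  qed
  moreover have "inj_on ((!) ?s) {..k}"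
    using assms(2) len by (intro inj_on_nth) auto
  ultimately show ?thesis unfolding pos_def by (simp add: card_image)
qed

lemma pos_add_row_of:
  assumes "finite A" "j \<in> A"
  shows "pos A j + row_of A j = Suc (card A)"
proof -
  have "{a \<in> A. a \<le> j} \<union> {a \<in> A. j \<le> a} = A" "{a \<in> A. a \<le> j} \<inter> {a \<in> A. j \<le> a} = {j}"
    using assms by auto
  then show ?thesis
    using card_Un_Int[of "{a \<in> A. a \<le> j}" "{a \<in> A. j \<le> a}"] assms(1) by (simp add: pos_def row_of_def)
qed

lemma pos_add_col_of:
  assumes "A \<subseteq> {1..n}" "j \<in> {1..n}"
  shows "pos A j + col_of n A j = j"
proof -
  have fin: "finite A" using assms(1) finite_subset by blast
  have "{a \<in> A. a \<le> j} \<union> {e \<in> {1..n} - A. e \<le> j} = {1..j}" using assms by auto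
  then have "card {a \<in> A. a \<le> j} + card {e \<in> {1..n} - A. e \<le> j} = card {1..j}"
    using fin by (subst card_Un_disjoint[symmetric]) auto
  then show ?thesis by (simp add: pos_def col_of_def)
qed

lemma sorted_list_pos:
  assumes "finite A" "j \<in> A"
  shows "sorted_list_of_set A ! (pos A j - 1) = j"
proof -
  have "j \<in> set (sorted_list_of_set A)" using assms by simp
  then obtain k where k: "k < length (sorted_list_of_set A)" "sorted_list_of_set A ! k = j"
    unfolding in_set_conv_nth by blast
  then have "pos A j = Suc k" using pos_sorted_list[OF assms(1), of k] by simp
  then show ?thesis using k by simp
qed

text \<open>The row of \<open>a_k\<close> has length \<open>a_k - k\<close>. Among the numbers up to
  \<open>a_k\<close>, \<open>k\<close> lie in \<open>A\<close>, so this length counts the columns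
  whose east steps precede the north step.\<close>

lemma box_in_row:
  assumes A: "A \<in> subsets r n" and j: "j \<in> A"
  shows "(row_of A j, q) \<in> boxes (partition_of A) \<longleftrightarrow> 1 \<le> q \<and> q \<le> col_of n A j"
proof -
  note A' = subsetsD[OF A]
  have fin: "finite A" "card A = r" using A' by auto
  have pr: "pos A j + row_of A j = Suc r" using pos_add_row_of[OF fin(1) j] fin by simp
  have p: "1 \<le> pos A j" "pos A j \<le> r" using bij_betw_pos[OF fin(1)] j fin by (auto simp: bij_betw_def)
  have len: "length (partition_of A) = r" using fin by (simp add: partition_of_def)
  have "r - Suc (row_of A j - 1) = pos A j - 1" using pr p by linarith
  moreover have "[0..<r] ! (pos A j - 1) = pos A j - 1" using p by simp
  ultimately have "partition_of A ! (row_of A j - 1) = sorted_list_of_set A ! (pos A j - 1) - Suc (pos A j - 1)"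
    using pr p fin by (simp add: partition_of_def rev_nth)
  also have "\<dots> = j - pos A j" using sorted_list_pos[OF fin(1) j] p by simp
  also have "\<dots> = col_of n A j" using pos_add_col_of[of A n j] A' j by auto
  finally show ?thesis using pr p len by (simp add: boxes_def)
qed

lemma box_of_in_boxes:
  assumes A: "A \<in> subsets r n" and ij: "(i, j) \<in> Inv n A"
  shows "box_of n A (i, j) \<in> boxes (partition_of A)"
proof -
  have "i \<in> {1..n} - A" "j \<in> A" "i < j" using ij by (auto simp: Inv_def)
  then have "col_of n A i \<le> col_of n A j" unfolding col_of_def by (intro card_mono) auto
  \<comment> \<open>Only the positivity of the column index is needed, and
    \<open>col_of n A i\<close> exceeds another natural number.\<close>
  moreover have "col_of n A 0 < col_of n A i" using col_of_less[of i n A 0] \<open>i \<in> {1..n} - A\<close> by simp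
  ultimately show ?thesis using box_in_row[OF A \<open>j \<in> A\<close>] by (simp add: box_of_def)
qed

lemma subset_of_partition:
  assumes "r \<le> n"
  shows "A \<in> subsets r n \<Longrightarrow> partition_of A \<in> Part r n \<and> subset_of r n (partition_of A) = A"
    "la \<in> Part r n \<Longrightarrow> subset_of r n la \<in> subsets r n \<and> partition_of (subset_of r n la) = la"
proof -
  note bij = bij_partition_of[OF assms]
  show "partition_of A \<in> Part r n \<and> subset_of r n (partition_of A) = A" if "A \<in> subsets r n"
    using bij that the_inv_into_f_f[of partition_of "subsets r n" A] unfolding subset_of_def
    by (auto simp: bij_betw_def)
  show "subset_of r n la \<in> subsets r n \<and> partition_of (subset_of r n la) = la" if "la \<in> Part r n"
    using bij that the_inv_into_into[of partition_of "subsets r n" la "subsets r n"]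
      f_the_inv_into_f[of partition_of "subsets r n" la] unfolding subset_of_def bij_betw_def
    by simp
qed

text \<open>Let \<open>j\<close> be the north step of the row and \<open>i\<close> the east step of
  the column. Then \<open>i < j\<close>, as the box lies in the diagram. Rows are numbered from the
  largest north step, so the box above has a north step \<open>j' > j\<close>, and the box to the
  left has an east step \<open>i' < i\<close>. The arcs \<open>(i', j)\<close> and
  \<open>(i, j')\<close> would cross.\<close>

lemma no_corner_boxes:
  assumes A: "A \<in> subsets r n" and S: "S \<subseteq> box_of n A ` InvQ r n A"
    and box: "(p, q) \<in> boxes (partition_of A)" and "p' < p" "(p', q) \<in> S" "q' < q" "(p, q') \<in> S"
  shows False
proof -
  note A' = subsetsD[OF A]
  obtain i j' where 1: "(i, j') \<in> InvQ r n A" "p' = row_of A j'" "q = col_of n A i"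
    using assms(5) S by (auto simp: box_of_def)
  obtain i' j where 2: "(i', j) \<in> InvQ r n A" "p = row_of A j" "q' = col_of n A i'"
    using assms(7) S by (auto simp: box_of_def)
  have m1: "i \<in> {1..n} - A" "j' \<in> A" using 1 by (auto simp: InvQ_def Inv_def)
  have m2: "i' \<in> {1..n} - A" "j \<in> A" using 2 by (auto simp: InvQ_def Inv_def)
  have "j < j'" using row_of_less[of A j' j] \<open>p' < p\<close> 1 2 m1 m2 A' by (cases j j' rule: linorder_cases) auto
  moreover have "i' < i" using col_of_less[of i' n A i] \<open>q' < q\<close> 1 2 m2 by (cases i i' rule: linorder_cases) auto
  moreover have "i < j"
  proof -
    have "col_of n A i \<le> col_of n A j" using box box_in_row[OF A m2(2)] 1 2 by simp
    moreover have "col_of n A j < col_of n A i" if "j < i" using col_of_less[OF m1(1) that] .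
    moreover have "i \<noteq> j" using m1 m2 by blast
    ultimately show ?thesis by (cases i j rule: linorder_cases) auto
  qed
  ultimately show False using InvQ_noncrossing[OF 2(1) 1(1)] A' by blast
qed

text \<open>The Le condition holds vacuously: no box of the shape, in \<open>S\<close> or not, has
  one box of \<open>S\<close> above it and another to its left.\<close>

lemma noncrossing_Le_diagram_subset:
  assumes A: "A \<in> subsets r n" and S: "S \<subseteq> box_of n A ` InvQ r n A"
  shows "noncrossing_Le_diagram (partition_of A) S"
proof -
  have "InvQ r n A \<subseteq> Inv n A" by (auto simp: InvQ_def)
  then have "box_of n A e \<in> boxes (partition_of A)" if "e \<in> InvQ r n A" for e
    using that box_of_in_boxes[OF A] by (cases e) blast
  then have sub: "S \<subseteq> boxes (partition_of A)" using S by blast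
  show ?thesis
    unfolding noncrossing_Le_diagram_def Le_diagram_def
    using no_corner_boxes[OF A S] sub by blast
qed

lemma orbit_cell_eq:
  assumes A: "A \<in> subsets r n" and r: "r \<le> n" and T: "T \<subseteq> InvQ r n A"
  shows "orbit_cell r n (partition_of A) (box_of n A ` T) = colspan r ` support_mats r n A T"
proof -
  note A' = subsetsD[OF A] and part = subset_of_partition(1)[OF r A]
  have D: "D r n (partition_of A) = box_of n A ` InvQ r n A" using part by (simp add: D_def)
  have QI: "InvQ r n A \<subseteq> Inv n A" by (auto simp: InvQ_def)
  have mem: "box_of n A (i, j) \<in> box_of n A ` U \<longleftrightarrow> (i, j) \<in> U"
    if "(i, j) \<in> Inv n A" "U \<subseteq> Inv n A" for i j U
  proof
    assume "box_of n A (i, j) \<in> box_of n A ` U"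
    then obtain a b where "(a, b) \<in> U" "box_of n A (i, j) = box_of n A (a, b)" by auto
    then show "(i, j) \<in> U" using box_of_inject[of A i j n a b] that A' by blast
  qed simp
  have TI: "T \<subseteq> Inv n A" using T QI by blast
  have "{M \<in> NC_cell_mats r n A. \<forall>(i, j) \<in> Inv n A.
       (box_of n A (i, j) \<in> box_of n A ` T \<longrightarrow> M i (pos A j) \<noteq> 0) \<and>
       (box_of n A (i, j) \<in> D r n (partition_of A) - box_of n A ` T \<longrightarrow> M i (pos A j) = 0)}
    = support_mats r n A T" (is "?L = _")
  proof (intro equalityI subsetI)
    fix M assume M: "M \<in> ?L"
    have "M i (pos A j) \<noteq> 0 \<longleftrightarrow> (i, j) \<in> T" if ij: "(i, j) \<in> InvQ r n A" for i j
    proof -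
      have I: "(i, j) \<in> Inv n A" using ij QI by blast
      then show ?thesis using M ij mem[OF I TI] mem[OF I QI] unfolding D by blast
    qed
    then show "M \<in> support_mats r n A T" using M by (auto simp: support_mats_def)
  next
    fix M assume M: "M \<in> support_mats r n A T"
    note M' = support_matsD[OF M A]
    have "(box_of n A (i, j) \<in> box_of n A ` T \<longrightarrow> M i (pos A j) \<noteq> 0) \<and>
       (box_of n A (i, j) \<in> D r n (partition_of A) - box_of n A ` T \<longrightarrow> M i (pos A j) = 0)"
      if I: "(i, j) \<in> Inv n A" for i j
      using M'(4) T mem[OF I TI] mem[OF I QI] unfolding D by blast
    then show "M \<in> ?L" using M'(1) by blast
  qed
  then show ?thesis unfolding orbit_cell_def using part by (simp add: Let_def)
qed

section \<open>Walks in the network of a noncrossing Le diagram\<close>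

abbreviation network :: "nat \<Rightarrow> nat set \<Rightarrow> (nat \<times> nat) set \<Rightarrow> (vertex \<times> vertex) set" where
  "network n A L \<equiv> horizontal_edges A L \<union> vertical_edges n A L"

definition entered :: "nat set \<Rightarrow> (nat \<times> nat) set \<Rightarrow> vertex list \<Rightarrow> (nat \<times> nat) set" where
  "entered A L P = {b. \<exists>u. (u, Box b) \<in> set (zip P (tl P)) \<and> (u, Box b) \<in> horizontal_edges A L}"

lemma entered_Cons: "entered A L (x # y # Q) =
    (if (x, y) \<in> horizontal_edges A L then {b. y = Box b} else {}) \<union> entered A L (y # Q)"
  unfolding entered_def by auto

lemma entered_single: "entered A L [x] = {}"
  by (simp add: entered_def)

lemma edge_from_Bdry:
  "(Bdry j, v) \<in> network n A L \<Longrightarrow> j \<in> A \<and> (\<exists>q. v = Box (row_of A j, q) \<and> (row_of A j, q) \<in> L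
     \<and> (\<forall>q'>q. (row_of A j, q') \<notin> L) \<and> (Bdry j, v) \<in> horizontal_edges A L)"
  by (auto simp: horizontal_edges_def vertical_edges_def)

lemma edge_from_Box:
  assumes "(Box (p, q), v) \<in> network n A L"
  obtains (left) q' where "v = Box (p, q')" "(p, q) \<in> L" "(p, q') \<in> L" "q' < q"
      "\<And>x. q' < x \<Longrightarrow> x < q \<Longrightarrow> (p, x) \<notin> L" "(Box (p, q), v) \<in> horizontal_edges A L"
    | (down) p' where "v = Box (p', q)" "(p, q) \<in> L" "(p', q) \<in> L" "p < p'"
      "\<And>x. p < x \<Longrightarrow> x < p' \<Longrightarrow> (x, q) \<notin> L" "(Box (p, q), v) \<notin> horizontal_edges A L"
    | (exit) i where "v = Bdry i" "i \<in> {1..n} - A" "q = col_of n A i" "(p, q) \<in> L"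
      "\<And>x. p < x \<Longrightarrow> (x, q) \<notin> L" "(Box (p, q), v) \<notin> horizontal_edges A L"
proof -
  consider "(Box (p, q), v) \<in> horizontal_edges A L"
    | "(Box (p, q), v) \<in> vertical_edges n A L" "(Box (p, q), v) \<notin> horizontal_edges A L"
    using assms by blast
  then show ?thesis
  proof cases
    case 1
    then obtain q' where "v = Box (p, q')" "(p, q) \<in> L" "(p, q') \<in> L" "q' < q"
      "\<forall>x. q' < x \<and> x < q \<longrightarrow> (p, x) \<notin> L"
      unfolding horizontal_edges_def by auto
    then show ?thesis using left 1 by blast
  next
    case 2
    then consider p' where "v = Box (p', q)" "(p, q) \<in> L" "(p', q) \<in> L" "p < p'"
        "\<forall>x. p < x \<and> x < p' \<longrightarrow> (x, q) \<notin> L"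
      | i where "v = Bdry i" "i \<in> {1..n} - A" "q = col_of n A i" "(p, q) \<in> L" "\<forall>x>p. (x, q) \<notin> L"
      unfolding vertical_edges_def by auto
    then show ?thesis
    proof cases
      case 1
      then show ?thesis using down 2(2) by blast
    next
      case 2
      then show ?thesis using exit \<open>(Box (p, q), v) \<notin> horizontal_edges A L\<close> by blast
    qed
  qed
qed

text \<open>The second condition on noncrossing Le diagrams, freed of the shape: the network meets
  boxes of \<open>L\<close> only.\<close>

definition no_corner :: "(nat \<times> nat) set \<Rightarrow> bool" where
  "no_corner L \<longleftrightarrow> (\<forall>p q p' q'. (p, q) \<in> L \<and> (p', q) \<in> L \<and> (p, q') \<in> L \<longrightarrow> \<not> (p' < p \<and> q' < q))"

abbreviation is_walk :: "nat \<Rightarrow> nat set \<Rightarrow> (nat \<times> nat) set \<Rightarrow> vertex list \<Rightarrow> bool" where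
  "is_walk n A L P \<equiv> successively (\<lambda>u v. (u, v) \<in> network n A L) P"

lemma walk_from_exit:
  assumes "is_walk n A L (Bdry i' # Q)" "i' \<notin> A"
  shows "Q = []"
proof (cases Q)
  case (Cons v R)
  then show ?thesis using assms edge_from_Bdry[where j=i' and v=v and n=n and A=A and L=L] by simp
qed

lemma noncrossing_Le_diagram_no_corner:
  assumes "noncrossing_Le_diagram la L"
  shows "no_corner L"
  unfolding no_corner_def
proof (intro allI impI notI)
  fix p q p' q' assume *: "(p, q) \<in> L \<and> (p', q) \<in> L \<and> (p, q') \<in> L" "p' < p \<and> q' < q"
  have "\<forall>(p, q)\<in>L. \<not> (\<exists>p'<p. (p', q) \<in> L) \<or> \<not> (\<exists>q'<q. (p, q') \<in> L)"
    using assms by (simp add: noncrossing_Le_diagram_def)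
  from bspec[OF this, of "(p, q)"] show False using * by auto
qed

text \<open>A box entered from above has no box to its left, so a walk that turns down never turns again.\<close>

lemma walk_from_Box:
  assumes nc: "no_corner L" and i: "i \<in> {1..n} - A"
  shows "is_walk n A L (Box (p, q) # Q) \<Longrightarrow> last (Box (p, q) # Q) = Bdry i \<Longrightarrow>
    (p, col_of n A i) \<in> L \<and> col_of n A i \<le> q
    \<and> entered A L (Box (p, q) # Q) = {(p, x) | x. (p, x) \<in> L \<and> col_of n A i \<le> x \<and> x < q}"
proof (induction Q arbitrary: p q)
  case (Cons v Q)
  have e: "(Box (p, q), v) \<in> network n A L" and w: "is_walk n A L (v # Q)"
    and l: "last (v # Q) = Bdry i" using Cons.prems by auto
  show ?case using e
  proof (cases rule: edge_from_Box)
    case (left q')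
    have IH: "(p, col_of n A i) \<in> L" "col_of n A i \<le> q'"
      "entered A L (v # Q) = {(p, x) | x. (p, x) \<in> L \<and> col_of n A i \<le> x \<and> x < q'}"
      using Cons.IH[of p q'] w l left(1) by auto
    have "(p, x) \<in> L \<and> col_of n A i \<le> x \<and> x < q
        \<longleftrightarrow> x = q' \<or> ((p, x) \<in> L \<and> col_of n A i \<le> x \<and> x < q')" for x
      using left(3,4) left(5)[of x] IH(2) by (cases x q' rule: linorder_cases) auto
    then show ?thesis using IH left(1,4,6) by (auto simp: entered_Cons)
  next
    case (down p')
    have IH: "(p', col_of n A i) \<in> L" "col_of n A i \<le> q"
      "entered A L (v # Q) = {(p', x) | x. (p', x) \<in> L \<and> col_of n A i \<le> x \<and> x < q}"
      using Cons.IH[of p' q] w l down(1) by auto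
    have "\<not> col_of n A i < q" using nc IH(1) down(2-4) unfolding no_corner_def by blast
    then have "col_of n A i = q" using IH(2) by simp
    then show ?thesis using IH(3) down(2,6) by (auto simp: entered_Cons)
  next
    case (exit i')
    then have "Q = []" using walk_from_exit w by blast
    then have "i' = i" using l exit(1) by simp
    then show ?thesis using exit \<open>Q = []\<close> by (auto simp: entered_Cons entered_single)
  qed
qed simp

text \<open>The exit column dictates every move. By \<open>walk_from_Box\<close> the walk cannot
  pass it on the left, and by \<open>no_corner\<close> it can turn down only in that column. Edges
  lead to the nearest box, so the next vertex is determined.\<close>

lemma walk_unique:
  assumes nc: "no_corner L" and i: "i \<in> {1..n} - A"
  shows "is_walk n A L (Box (p, q) # Q) \<Longrightarrow> last (Box (p, q) # Q) = Bdry i \<Longrightarrow>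
    is_walk n A L (Box (p, q) # Q') \<Longrightarrow> last (Box (p, q) # Q') = Bdry i \<Longrightarrow> Q = Q'"
proof (induction Q arbitrary: p q Q')
  case (Cons v Q)
  obtain v' R where Q': "Q' = v' # R" using Cons.prems(4) by (cases Q') auto
  have step: "(\<exists>q'. u = Box (p, q') \<and> col_of n A i \<le> q' \<and> q' < q \<and> (p, q') \<in> L
        \<and> (\<forall>x. q' < x \<and> x < q \<longrightarrow> (p, x) \<notin> L))
      \<or> (\<exists>p'. u = Box (p', q) \<and> col_of n A i = q \<and> p < p' \<and> (p', q) \<in> L
        \<and> (\<forall>x. p < x \<and> x < p' \<longrightarrow> (x, q) \<notin> L))
      \<or> (u = Bdry i \<and> S = [] \<and> col_of n A i = q \<and> (\<forall>x>p. (x, q) \<notin> L))"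
    if w: "is_walk n A L (Box (p, q) # u # S)" and l: "last (Box (p, q) # u # S) = Bdry i" for u S
  proof -
    have e: "(Box (p, q), u) \<in> network n A L" and w': "is_walk n A L (u # S)"
      and l': "last (u # S) = Bdry i" using w l by auto
    show ?thesis using e
    proof (cases rule: edge_from_Box)
      case (left q')
      then have "col_of n A i \<le> q'" using walk_from_Box[OF nc i] w' l' by blast
      then show ?thesis using left by blast
    next
      case (down p')
      then have "(p', col_of n A i) \<in> L" "col_of n A i \<le> q" using walk_from_Box[OF nc i] w' l' by blast+
      then have "col_of n A i = q" using nc down(2-4) unfolding no_corner_def by (metis le_neq_implies_less)
      then show ?thesis using down by blast
    next
      case (exit i')
      then have "S = []" using walk_from_exit w' by blast
      then have "i' = i" using l' exit(1) by simp
      then show ?thesis using exit \<open>S = []\<close> by blast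
    qed
  qed
  note s1 = step[OF Cons.prems(1,2)] and s2 = step[OF Cons.prems(3,4)[unfolded Q']]
  have "v = v' \<and> ((\<exists>b. v = Box b) \<or> Q = [] \<and> R = [])"
    using s1
  proof (elim disjE exE conjE)
    fix a assume a: "v = Box (p, a)" "col_of n A i \<le> a" "a < q" "(p, a) \<in> L"
      "\<forall>x. a < x \<and> x < q \<longrightarrow> (p, x) \<notin> L"
    then obtain b where b: "v' = Box (p, b)" "b < q" "(p, b) \<in> L" "\<forall>x. b < x \<and> x < q \<longrightarrow> (p, x) \<notin> L"
      using s2 by auto
    have "a = b" using a b by (metis linorder_neqE_nat)
    then show ?thesis using a b by simp
  next
    fix a assume a: "v = Box (a, q)" "col_of n A i = q" "p < a" "(a, q) \<in> L"
      "\<forall>x. p < x \<and> x < a \<longrightarrow> (x, q) \<notin> L"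
    then obtain b where b: "v' = Box (b, q)" "p < b" "(b, q) \<in> L" "\<forall>x. p < x \<and> x < b \<longrightarrow> (x, q) \<notin> L"
      using s2 by auto
    have "a = b" using a b by (metis linorder_neqE_nat)
    then show ?thesis using a b by simp
  next
    assume a: "v = Bdry i" "Q = []" "col_of n A i = q" "\<forall>x>p. (x, q) \<notin> L"
    then have "v' = Bdry i \<and> R = []" using s2 by auto
    then show ?thesis using a by simp
  qed
  then show ?case
  proof (elim conjE disjE exE)
    fix b assume v: "v = v'" "v = Box b"
    obtain p' q' where b: "b = (p', q')" by (cases b)
    have "is_walk n A L (Box (p', q') # Q)" "last (Box (p', q') # Q) = Bdry i"
      using Cons.prems(1,2) v b by simp_all
    moreover have "is_walk n A L (Box (p', q') # R)" "last (Box (p', q') # R) = Bdry i"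
      using Cons.prems(3,4) Q' v b by simp_all
    ultimately have "Q = R" by (rule Cons.IH)
    then show ?thesis using v Q' by simp
  qed (use Q' in simp)
qed simp

section \<open>Existence and weight of the walk\<close>

lemma walk_down_exists:
  assumes "finite L" "i \<in> {1..n} - A"
  shows "(p, col_of n A i) \<in> L \<Longrightarrow>
    \<exists>Q. is_walk n A L (Box (p, col_of n A i) # Q) \<and> last (Box (p, col_of n A i) # Q) = Bdry i"
proof (induction "card {x. p < x \<and> (x, col_of n A i) \<in> L}" arbitrary: p rule: less_induct)
  case less
  let ?q = "col_of n A i"
  let ?X = "\<lambda>p. {x. p < x \<and> (x, ?q) \<in> L}"
  have fin: "finite (?X p)" for p
  proof (rule finite_subset)
    show "?X p \<subseteq> fst ` L" by force
  qed (use assms(1) in simp)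
  show ?case
  proof (cases "?X p = {}")
    case True
    then have "(Box (p, ?q), Bdry i) \<in> vertical_edges n A L"
      using assms(2) less.prems by (auto simp: vertical_edges_def)
    then show ?thesis by (intro exI[of _ "[Bdry i]"]) simp
  next
    case False
    define p' where "p' = Min (?X p)"
    have p': "p' \<in> ?X p" using Min_in[OF fin False] by (simp only: p'_def)
    have min: "p' \<le> x" if "x \<in> ?X p" for x using Min_le[OF fin that] by (simp only: p'_def)
    have "?X p' \<subset> ?X p" using p' by auto
    then have "card (?X p') < card (?X p)" using fin by (intro psubset_card_mono)
    then obtain Q where Q: "is_walk n A L (Box (p', ?q) # Q)" "last (Box (p', ?q) # Q) = Bdry i"
      using less.hyps[of p'] p' by auto
    have "(Box (p, ?q), Box (p', ?q)) \<in> vertical_edges n A L"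
      using less.prems p' min unfolding vertical_edges_def by fastforce
    then show ?thesis using Q by (intro exI[of _ "Box (p', ?q) # Q"]) simp
  qed
qed

lemma walk_left_exists:
  assumes "finite L" "i \<in> {1..n} - A" "(p, col_of n A i) \<in> L"
  shows "(p, q) \<in> L \<Longrightarrow> col_of n A i \<le> q \<Longrightarrow>
    \<exists>Q. is_walk n A L (Box (p, q) # Q) \<and> last (Box (p, q) # Q) = Bdry i"
proof (induction q rule: less_induct)
  case (less q)
  show ?case
  proof (cases "col_of n A i = q")
    case True
    then show ?thesis using walk_down_exists[OF assms(1,2,3)] by simp
  next
    case False
    let ?X = "{x. x < q \<and> (p, x) \<in> L}"
    have fin: "finite ?X" by simp
    have ne: "col_of n A i \<in> ?X" using False less.prems assms(3) by simp
    define q' where "q' = Max ?X"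
    have q': "q' \<in> ?X" using Max_in[OF fin] ne unfolding q'_def by blast
    have max: "x \<le> q'" if "x \<in> ?X" for x using Max_ge[OF fin that] by (simp only: q'_def)
    obtain Q where Q: "is_walk n A L (Box (p, q') # Q)" "last (Box (p, q') # Q) = Bdry i"
      using less.IH[of q'] q' max[OF ne] by auto
    have "(Box (p, q), Box (p, q')) \<in> horizontal_edges A L"
      using less.prems(1) q' max unfolding horizontal_edges_def by fastforce
    then show ?thesis using Q by (intro exI[of _ "Box (p, q') # Q"]) simp
  qed
qed

text \<open>The only possible walk enters the row of \<open>j\<close> at its rightmost box, passes
  every box of the row as far as the column of \<open>i\<close>, and goes down from there. Vertical
  edges carry no weight, which leaves a product over the end of the row.\<close>

lemma sum_walks:
  assumes nc: "no_corner L" and fin: "finite L" and j: "j \<in> A" and i: "i \<in> {1..n} - A"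
  shows "(\<Sum>P\<in>walks n A L j i. walk_weight A L c P) =
    (if (row_of A j, col_of n A i) \<in> L
     then \<Prod>x | (row_of A j, x) \<in> L \<and> col_of n A i \<le> x. c (row_of A j, x) else 0)"
proof -
  let ?p = "row_of A j" and ?q = "col_of n A i"
  have walk: "\<exists>q Q. P = Bdry j # Box (?p, q) # Q \<and> (?p, q) \<in> L \<and> (\<forall>q'>q. (?p, q') \<notin> L)
      \<and> (Bdry j, Box (?p, q)) \<in> horizontal_edges A L
      \<and> is_walk n A L (Box (?p, q) # Q) \<and> last (Box (?p, q) # Q) = Bdry i"
    if P: "P \<in> walks n A L j i" for P
  proof -
    have P': "P \<noteq> []" "hd P = Bdry j" "last P = Bdry i" "is_walk n A L P"
      using P by (auto simp: walks_def)
    then obtain R where R: "P = Bdry j # R" by (metis list.collapse)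
    have "i \<noteq> j" using i j by blast
    then obtain v Q where vQ: "R = v # Q" using R P'(3) by (cases R) auto
    then have e: "(Bdry j, v) \<in> network n A L" "is_walk n A L (v # Q)" "last (v # Q) = Bdry i"
      using P'(3,4) R by auto
    then show ?thesis using edge_from_Bdry[OF e(1)] R vQ by auto
  qed
  show ?thesis
  proof (cases "(?p, ?q) \<in> L")
    case False
    have "walks n A L j i = {}"
    proof (rule ccontr)
      assume "walks n A L j i \<noteq> {}"
      then obtain P where "P \<in> walks n A L j i" by blast
      then obtain q Q where "is_walk n A L (Box (?p, q) # Q)" "last (Box (?p, q) # Q) = Bdry i"
        using walk by blast
      then show False using walk_from_Box[OF nc i] False by blast
    qed
    then show ?thesis using False by simp
  next
    case True
    let ?X = "{x. (?p, x) \<in> L}"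
    have finX: "finite ?X" by (rule finite_subset[of _ "snd ` L"]) (use fin in force)+
    define q where "q = Max ?X"
    have q: "(?p, q) \<in> L" "x \<le> q" if "(?p, x) \<in> L" for x
      using Max_in[OF finX] Max_ge[OF finX, of x] that unfolding q_def by auto
    note qL = q(1)[OF True] and qm = q(2)
    obtain Q where Q: "is_walk n A L (Box (?p, q) # Q)" "last (Box (?p, q) # Q) = Bdry i"
      using walk_left_exists[OF fin i True qL qm[OF True]] by blast
    have e: "(Bdry j, Box (?p, q)) \<in> horizontal_edges A L"
      using j qL qm unfolding horizontal_edges_def by fastforce
    let ?P = "Bdry j # Box (?p, q) # Q"
    have "?P \<in> walks n A L j i" using Q e by (simp add: walks_def)
    moreover have "P = ?P" if P': "P \<in> walks n A L j i" for P
    proof -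
      obtain q' Q' where P: "P = Bdry j # Box (?p, q') # Q'" "(?p, q') \<in> L" "\<forall>x>q'. (?p, x) \<notin> L"
        "is_walk n A L (Box (?p, q') # Q')" "last (Box (?p, q') # Q') = Bdry i"
        using walk[OF P'] by blast
      have "q' = q" using qm[OF P(2)] P(3) qL by (cases "q' < q") auto
      then show ?thesis using walk_unique[OF nc i P(4,5)] Q P(1) by blast
    qed
    ultimately have "walks n A L j i = {?P}" by blast
    moreover have "entered A L ?P = Pair ?p ` {x. (?p, x) \<in> L \<and> ?q \<le> x}"
    proof -
      have "entered A L ?P = insert (?p, q) {(?p, x) | x. (?p, x) \<in> L \<and> ?q \<le> x \<and> x < q}"
        using walk_from_Box[OF nc i Q] e by (auto simp: entered_Cons)
      moreover have "(?p, x) \<in> L \<and> ?q \<le> x \<longleftrightarrow> x = q \<or> (?p, x) \<in> L \<and> ?q \<le> x \<and> x < q" for x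
        using qL qm[of x] qm[OF True] by (cases "x = q") auto
      ultimately show ?thesis by auto
    qed
    moreover have "walk_weight A L c ?P = prod c (entered A L ?P)"
      by (simp add: walk_weight_def entered_def)
    ultimately show ?thesis using True by (simp add: prod.reindex inj_on_def)
  qed
qed

section \<open>Positroid cells of noncrossing Le diagrams\<close>

text \<open>A triangular system in multiplicative form: from the largest element downwards, each new
  factor is the prescribed product divided by the product of the factors already chosen. It recovers
  the weights of a row from its walk sums.\<close>

lemma suffix_products:
  fixes f :: "nat \<Rightarrow> 'a :: field"
  assumes "finite F" "\<And>q. q \<in> F \<Longrightarrow> f q \<noteq> 0"
  shows "\<exists>c. (\<forall>q\<in>F. c q \<noteq> 0) \<and> (\<forall>q\<in>F. prod c (F \<inter> {q..}) = f q)"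
  using assms
proof (induction F rule: finite_linorder_min_induct)
  case (insert b F)
  have "\<exists>c. (\<forall>q\<in>F. c q \<noteq> 0) \<and> (\<forall>q\<in>F. prod c (F \<inter> {q..}) = f q)"
    by (rule insert.IH, rule insert.prems) simp
  then obtain c where c: "\<And>q. q \<in> F \<Longrightarrow> c q \<noteq> 0" "\<And>q. q \<in> F \<Longrightarrow> prod c (F \<inter> {q..}) = f q" by blast
  have bF: "b \<notin> F" using insert.hyps by blast
  let ?c = "c(b := f b / prod c F)"
  have agree: "prod ?c G = prod c G" if "G \<subseteq> F" for G
    using that bF by (intro prod.cong) auto
  have pF: "prod c F \<noteq> 0" using c(1) insert.hyps(1) by simp
  have "?c q \<noteq> 0" if "q \<in> insert b F" for q using that c(1) pF insert.prems by auto
  moreover have "prod ?c (insert b F \<inter> {q..}) = f q" if "q \<in> insert b F" for q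
  proof (cases "q = b")
    case True
    have "insert b F \<inter> {q..} = insert b F" using True insert.hyps(2) by force
    then show ?thesis using True agree[of F] bF insert.hyps(1) pF by simp
  next
    case False
    then have "q \<in> F" "insert b F \<inter> {q..} = F \<inter> {q..}" using that insert.hyps(2) by force+
    then show ?thesis using agree[of "F \<inter> {q..}"] c(2) by simp
  qed
  ultimately show ?case by blast
qed simp

lemma permutes_eqI_but_one:
  assumes "p permutes S" "s permutes S" "k0 \<in> S" "\<And>k. k \<in> S \<Longrightarrow> k \<noteq> k0 \<Longrightarrow> p k = s k"
  shows "p = s"
proof -
  have img: "t ` (S - {k0}) = S - {t k0}" if "t permutes S" for t
    using image_set_diff[OF permutes_inj[OF that], of S "{k0}"] permutes_image[OF that]
    by (simp only: image_insert image_empty)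
  have "p ` (S - {k0}) = s ` (S - {k0})"
    by (rule image_cong[OF refl]) (simp add: assms(4))
  then have "S - {p k0} = S - {s k0}" unfolding img[OF assms(1)] img[OF assms(2)] .
  moreover have "p k0 \<in> S" using assms(3) permutes_in_image[OF assms(1), of k0] by blast
  ultimately have "p k0 = s k0" by blast
  show ?thesis
  proof
    fix k
    consider "k = k0" | "k \<in> S" "k \<noteq> k0" | "k \<notin> S" by blast
    then show "p k = s k"
      using \<open>p k0 = s k0\<close> assms(4) permutes_not_in[OF assms(1)] permutes_not_in[OF assms(2)]
      by cases simp_all
  qed
qed

text \<open>The rows of \<open>A\<close> form an identity matrix, so one permutation contributes to the determinant.\<close>

lemma pluecker_exchange:
  assumes A: "A \<in> subsets r n" and j: "j \<in> A" and i: "i \<in> {1..n}" "i = j \<or> i \<notin> A"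
  shows "\<exists>s. s \<noteq> 0 \<and> (\<forall>M\<in>cell_mats n A. pluecker (insert i (A - {j})) M = s * M i (pos A j))"
proof -
  have A': "A \<subseteq> {1..n}" "finite A" "card A = r" using subsetsD[OF A] by auto
  define B where "B = insert i (A - {j})"
  have finB: "finite B" and cB: "card B = r"
    using i j A' card_gt_0_iff[of A] by (auto simp: B_def card_insert_if)
  define sl where "sl = sorted_list_of_set B"
  have sl: "length sl = r" "distinct sl" "set sl = B" using finB cB by (auto simp: sl_def)
  \<comment> \<open>A row \<open>b\<close> of \<open>A - {j}\<close> has its only nonzero entry in
    the column of \<open>b\<close>, so the row \<open>i\<close> is left with the column of
    \<open>j\<close>. \<open>s\<close> is this matching of rows and columns, counted from 0 and
    extended by the identity as \<open>permutes\<close> demands.\<close>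
  define g where "g b = (if b = i then j else b)" for b
  have gA: "g b \<in> A" if "b \<in> B" for b using that j by (auto simp: g_def B_def)
  have ginj: "inj_on g B" using i by (auto simp: g_def B_def inj_on_def)
  define s where "s k = (if k < r then pos A (g (sl ! k)) - 1 else k)" for k
  have slB: "sl ! k \<in> B" if "k < r" for k using that sl nth_mem by metis
  have posr: "pos A a \<in> {1..r}" if "a \<in> A" for a
    using bij_betw_pos[OF A'(2)] A'(3) that by (auto simp: bij_betw_def)
  have pinj: "pos A a = pos A b \<longleftrightarrow> a = b" if "a \<in> A" "b \<in> A" for a b
    using bij_betw_pos[OF A'(2)] that by (auto simp: bij_betw_def inj_on_def)
  have Suc_s: "Suc (s k) = pos A (g (sl ! k))" if "k < r" for k
    using posr[OF gA[OF slB[OF that]]] that by (simp add: s_def)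
  have sp: "s permutes {0..<r}"
  proof (rule inj_imp_permutes)
    show "inj_on s {0..<r}"
    proof (rule inj_onI)
      fix k l assume kl: "k \<in> {0..<r}" "l \<in> {0..<r}" "s k = s l"
      then have "pos A (g (sl ! k)) = pos A (g (sl ! l))" using Suc_s[of k] Suc_s[of l] by simp
      then have "g (sl ! k) = g (sl ! l)" using pinj gA slB kl by simp
      then have "sl ! k = sl ! l" using ginj slB kl by (auto dest: inj_onD)
      then show "k = l" using sl kl nth_eq_iff_index_eq by auto
    qed
    show "s k \<in> {0..<r}" if "k \<in> {0..<r}" for k
      using Suc_s[of k] posr[OF gA[OF slB[of k]]] that by auto
  qed (auto simp: s_def)
  obtain k0 where k0: "k0 < r" "sl ! k0 = i" using sl by (metis B_def in_set_conv_nth insertI1)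
  have other: "sl ! k \<in> A \<and> g (sl ! k) = sl ! k" if "k < r" "k \<noteq> k0" for k
  proof -
    have "sl ! k \<noteq> i" using that k0 sl nth_eq_iff_index_eq by metis
    then show ?thesis using slB[OF that(1)] by (auto simp: B_def g_def)
  qed
  have "pluecker B M = signof s * M i (pos A j)" if M: "M \<in> cell_mats n A" for M
  proof -
    let ?t = "\<lambda>p. \<Prod>k = 0..<r. M (sl ! k) (Suc (p k))"
    have "pluecker B M = (\<Sum>p | p permutes {0..<r}. signof p * ?t p)"
    proof -
      have "p k < r" if "p permutes {0..<r}" "k < r" for p k
        using permutes_in_image[OF that(1), of k] that(2) by simp
      then show ?thesis
        unfolding pluecker_def cB sl_def[symmetric]
        by (subst det_def'[of _ r]) (auto intro!: sum.cong prod.cong)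
    qed
    also have "\<dots> = (\<Sum>p\<in>{s}. signof p * ?t p)"
    proof (rule sum.mono_neutral_right)
      show "finite {p. p permutes {0..<r}}" by (rule finite_permutations) simp
      show "{s} \<subseteq> {p. p permutes {0..<r}}" using sp by simp
      show "\<forall>p\<in>{p. p permutes {0..<r}} - {s}. signof p * ?t p = 0"
      proof
        \<comment> \<open>Different permutations cannot differ at one index only, so
          \<open>p\<close> and \<open>s\<close> differ at a row other than \<open>i\<close>; there
          \<open>p\<close> picks a zero of the identity matrix.\<close>
        fix p assume p: "p \<in> {p. p permutes {0..<r}} - {s}"
        then obtain k where k: "k < r" "k \<noteq> k0" "p k \<noteq> s k"
          using permutes_eqI_but_one[of p "{0..<r}" s k0] sp k0 by auto
        have "p k < r" using p k(1) permutes_in_image[of p "{0..<r}" k] by simp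
        then have "Suc (p k) \<in> pos A ` A"
          using bij_betw_pos[OF A'(2)] A'(3) by (simp add: bij_betw_def)
        then obtain a where a: "a \<in> A" "Suc (p k) = pos A a" by blast
        have "a \<noteq> sl ! k" using Suc_s[OF k(1)] other[OF k(1,2)] a k(3) by auto
        then have "M (sl ! k) (Suc (p k)) = 0"
          using cell_mats_pivot[OF M, of "sl ! k" a] other[OF k(1,2)] a A' by simp
        then have "?t p = 0" using k(1) by (intro prod_zero) auto
        then show "signof p * ?t p = 0" by simp
      qed
    qed
    also have "\<dots> = signof s * ?t s" by simp
    also have "?t s = (\<Prod>k = 0..<r. if k = k0 then M i (pos A j) else 1)"
    proof (rule prod.cong[OF refl])
      fix k assume "k \<in> {0..<r}"
      then have k: "k < r" by simp
      show "M (sl ! k) (Suc (s k)) = (if k = k0 then M i (pos A j) else 1)"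
      proof (cases "k = k0")
        case True
        then show ?thesis using Suc_s[OF k] k0 by (simp add: g_def)
      next
        case False
        then show ?thesis using Suc_s[OF k] other[OF k False]
          cell_mats_pivot[OF M, of "sl ! k" "sl ! k"] A' by simp
      qed
    qed
    also have "\<dots> = M i (pos A j)" using k0(1) by simp
    finally show ?thesis .
  qed
  moreover have "signof s \<noteq> (0 :: complex)" by (simp add: sign_def)
  ultimately show ?thesis unfolding B_def by blast
qed

text \<open>One factor, a quotient of two signs, serves the whole cell. The denominator comes from
  the exchange of \<open>j\<close> with itself, so \<open>pluecker A M\<close> is constant on the
  cell.\<close>

lemma pluecker_ratio:
  assumes A: "A \<in> subsets r n" and ij: "(i, j) \<in> Inv n A"
  shows "\<exists>s. s \<noteq> 0 \<and> (\<forall>M\<in>cell_mats n A.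
    pluecker (insert i (A - {j})) M / pluecker A M = s * M i (pos A j))"
proof -
  have *: "j \<in> A" "i \<in> {1..n}" "i \<notin> A" "j \<in> {1..n}" using ij subsetsD[OF A] by (auto simp: Inv_def)
  obtain s where s: "s \<noteq> 0" "\<forall>M\<in>cell_mats n A. pluecker (insert i (A - {j})) M = s * M i (pos A j)"
    using pluecker_exchange[OF A *(1,2)] *(3) by blast
  obtain s' where s': "s' \<noteq> 0" "\<forall>M\<in>cell_mats n A. pluecker (insert j (A - {j})) M = s' * M j (pos A j)"
    using pluecker_exchange[OF A *(1,4)] by blast
  have "pluecker A M = s'" if "M \<in> cell_mats n A" for M
    using s'(2) that *(1) by (simp add: insert_absorb cell_mats_def)
  then show ?thesis using s s'(1) by (intro exI[of _ "s / s'"]) auto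
qed

text \<open>Up to a nonzero factor the ratios are the coordinates, and each walk sum is a suffix
  product of a row or 0. So the support is exactly \<open>T\<close>; conversely, weights exist for
  any nonzero coordinates on \<open>T\<close>.\<close>

lemma positroid_cell_eq:
  assumes A: "A \<in> subsets r n" and r: "r \<le> n" and T: "T \<subseteq> InvQ r n A"
  shows "positroid_cell r n (partition_of A) (box_of n A ` T) = colspan r ` support_mats r n A T"
proof -
  have A': "A \<subseteq> {1..n}" "finite A" "card A = r" using subsetsD[OF A] by auto
  let ?L = "box_of n A ` T"
  have QI: "InvQ r n A \<subseteq> Inv n A" by (auto simp: InvQ_def)
  have finL: "finite ?L" using T finite_InvQ[OF A'(1)] finite_subset by blast
  have nc: "no_corner ?L"
    using T by (intro noncrossing_Le_diagram_no_corner[OF noncrossing_Le_diagram_subset[OF A]]) blast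
  have mem: "(row_of A j, col_of n A i) \<in> ?L \<longleftrightarrow> (i, j) \<in> T" if "(i, j) \<in> Inv n A" for i j
  proof
    assume "(row_of A j, col_of n A i) \<in> ?L"
    then obtain a b where "(a, b) \<in> T" "box_of n A (i, j) = box_of n A (a, b)"
      by (auto simp: box_of_def)
    then show "(i, j) \<in> T" using box_of_inject[OF A'(2) that, of a b] T QI by blast
  qed (force simp: box_of_def)
  have "\<forall>e\<in>Inv n A. \<exists>s. s \<noteq> 0 \<and> (\<forall>M\<in>cell_mats n A.
    pluecker (insert (fst e) (A - {snd e})) M / pluecker A M = s * M (fst e) (pos A (snd e)))"
    using pluecker_ratio[OF A] by fastforce
  from bchoice[OF this] obtain s where s': "\<forall>e\<in>Inv n A. s e \<noteq> 0 \<and> (\<forall>M\<in>cell_mats n A.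
    pluecker (insert (fst e) (A - {snd e})) M / pluecker A M = s e * M (fst e) (pos A (snd e)))" ..
  have s: "s (i, j) \<noteq> 0" "M \<in> cell_mats n A \<Longrightarrow>
      pluecker (insert i (A - {j})) M / pluecker A M = s (i, j) * M i (pos A j)"
    if "(i, j) \<in> Inv n A" for i j M
    using bspec[OF s' that] by simp_all
  define W :: "(nat \<times> nat \<Rightarrow> complex) \<Rightarrow> nat \<Rightarrow> nat \<Rightarrow> complex" where
    "W c i j = (\<Prod>x | (row_of A j, x) \<in> ?L \<and> col_of n A i \<le> x. c (row_of A j, x))" for c i j
  have walks: "(\<Sum>P\<in>walks n A ?L j i. walk_weight A ?L c P) = (if (i, j) \<in> T then W c i j else 0)"
    if ij: "(i, j) \<in> Inv n A" for i j c
    using sum_walks[OF nc finL, of j A i n] ij mem[OF ij] by (simp add: Inv_def W_def)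
  have fr: "finite {x. (p, x) \<in> ?L}" for p
  proof (rule finite_subset)
    have "x \<in> snd ` ?L" if "(p, x) \<in> ?L" for x using imageI[OF that, of snd] by simp
    then show "{x. (p, x) \<in> ?L} \<subseteq> snd ` ?L" by blast
  qed (use finL in simp)
  have "{M \<in> cell_mats n A. \<exists>c. (\<forall>b\<in>?L. c b \<noteq> 0) \<and>
       (\<forall>(i, j) \<in> Inv n A. pluecker (insert i (A - {j})) M / pluecker A M
          = (\<Sum>P \<in> walks n A ?L j i. walk_weight A ?L c P))} = support_mats r n A T" (is "?X = _")
  proof (intro equalityI subsetI)
    fix M assume "M \<in> ?X"
    then obtain c where M: "M \<in> cell_mats n A" and c: "\<And>b. b \<in> ?L \<Longrightarrow> c b \<noteq> 0"
      and eq: "\<And>i j. (i, j) \<in> Inv n A \<Longrightarrow> pluecker (insert i (A - {j})) M / pluecker A M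
          = (\<Sum>P \<in> walks n A ?L j i. walk_weight A ?L c P)" by blast
    have "W c i j \<noteq> 0" for i j
    proof -
      have "finite {x. (row_of A j, x) \<in> ?L \<and> col_of n A i \<le> x}"
        by (rule finite_subset[OF _ fr[of "row_of A j"]]) blast
      then show ?thesis using c unfolding W_def by simp
    qed
    then have M0: "M i (pos A j) \<noteq> 0 \<longleftrightarrow> (i, j) \<in> T" if "(i, j) \<in> Inv n A" for i j
      using eq[OF that] s(1)[OF that] unfolding s(2)[OF that M] walks[OF that] by (cases "(i, j) \<in> T") auto
    have "M i (pos A j) = 0" if "(i, j) \<in> Inv n A - InvQ r n A" for i j
      using M0[of i j] that T by blast
    then have "M \<in> NC_cell_mats r n A" using M by (auto simp: NC_cell_mats_def)
    moreover have "M i (pos A j) \<noteq> 0 \<longleftrightarrow> (i, j) \<in> T" if "(i, j) \<in> InvQ r n A" for i j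
      using M0 that QI by blast
    ultimately show "M \<in> support_mats r n A T" by (auto simp: support_mats_def)
  next
    fix M assume M: "M \<in> support_mats r n A T"
    note M' = support_matsD[OF M A]
    have Mc: "M \<in> cell_mats n A" using M'(1) by (simp add: NC_cell_mats_def)
    \<comment> \<open>The value prescribed for the walk that turns down at the box \<open>b\<close>,
      with the sign included.\<close>
    define f where "f = (\<lambda>b. let (i, j) = inv_into T (box_of n A) b in s (i, j) * M i (pos A j))"
    have inj: "inj_on (box_of n A) T"
    proof (rule inj_onI)
      fix e e' assume *: "e \<in> T" "e' \<in> T" "box_of n A e = box_of n A e'"
      then show "e = e'" using box_of_inject[OF A'(2), of "fst e" "snd e" n "fst e'" "snd e'"] T QI
        by (auto simp: prod_eq_iff)
    qed
    have f: "f (row_of A j, col_of n A i) = s (i, j) * M i (pos A j)" if "(i, j) \<in> T" for i j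
      using inv_into_f_f[OF inj that] by (simp add: f_def box_of_def)
    have "f b \<noteq> 0" if b: "b \<in> ?L" for b
    proof -
      obtain i j where ij: "(i, j) \<in> T" "b = (row_of A j, col_of n A i)"
        using b by (auto simp: box_of_def)
      then have "(i, j) \<in> InvQ r n A" "(i, j) \<in> Inv n A" using T QI by blast+
      then show ?thesis using f[OF ij(1)] s(1) M'(4) ij by simp
    qed
    \<comment> \<open>A walk is weighted within a single row, so the weights can be chosen for each
      row separately.\<close>
    then have "\<forall>p. \<exists>c. (\<forall>q\<in>{x. (p, x) \<in> ?L}. c q \<noteq> 0)
        \<and> (\<forall>q\<in>{x. (p, x) \<in> ?L}. prod c ({x. (p, x) \<in> ?L} \<inter> {q..}) = f (p, q))"
      by (intro allI suffix_products fr) blast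
    from choice[OF this] obtain c where c': "\<forall>p. (\<forall>q\<in>{x. (p, x) \<in> ?L}. c p q \<noteq> 0)
        \<and> (\<forall>q\<in>{x. (p, x) \<in> ?L}. prod (c p) ({x. (p, x) \<in> ?L} \<inter> {q..}) = f (p, q))" ..
    have c: "c p q \<noteq> 0" "prod (c p) ({x. (p, x) \<in> ?L} \<inter> {q..}) = f (p, q)"
      if "(p, q) \<in> ?L" for p q
      using c' that by blast+
    let ?c = "\<lambda>b. c (fst b) (snd b)"
    have Wf: "W ?c i j = s (i, j) * M i (pos A j)" if ij: "(i, j) \<in> T" for i j
    proof -
      have "(row_of A j, col_of n A i) \<in> ?L" using ij mem T QI by blast
      moreover have "{x. (row_of A j, x) \<in> ?L \<and> col_of n A i \<le> x}
          = {x. (row_of A j, x) \<in> ?L} \<inter> {col_of n A i..}" by auto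
      ultimately show ?thesis using c(2) f[OF ij] unfolding W_def by simp
    qed
    have pl: "pluecker (insert i (A - {j})) M / pluecker A M
          = (\<Sum>P \<in> walks n A ?L j i. walk_weight A ?L ?c P)" if ij: "(i, j) \<in> Inv n A" for i j
    proof (cases "(i, j) \<in> T")
      case True
      then show ?thesis unfolding s(2)[OF ij Mc] walks[OF ij] using Wf by simp
    next
      case False
      have "j \<in> A" "i \<noteq> j" using ij by (auto simp: Inv_def)
      then have "M i (pos A j) = 0" using M'(3,4) False by blast
      then show ?thesis unfolding s(2)[OF ij Mc] walks[OF ij] using False by simp
    qed
    have "?c b \<noteq> 0" if "b \<in> ?L" for b using that c(1) by (cases b) simp
    then have c0: "\<forall>b\<in>?L. ?c b \<noteq> 0" by blast
    have "\<exists>c. (\<forall>b\<in>?L. c b \<noteq> 0) \<and>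
       (\<forall>(i, j) \<in> Inv n A. pluecker (insert i (A - {j})) M / pluecker A M
          = (\<Sum>P \<in> walks n A ?L j i. walk_weight A ?L c P))"
      by (rule exI[of _ ?c], rule conjI[OF c0]) (clarify, rule pl)
    then show "M \<in> ?X" using Mc by simp
  qed
  then show ?thesis
    unfolding positroid_cell_def using subset_of_partition(1)[OF r A] by (simp add: Let_def)
qed

theorem corollary6p5:
  fixes r n :: nat
  assumes "r \<le> n"
  shows "(\<forall>t \<in> torus n. \<forall>V \<in> QGr r n. torus_act t V \<in> QGr r n)
    \<and> {torus_orbit n V | V. V \<in> QGr r n}
        = {orbit_cell r n la S | la S. la \<in> Part r n \<and> S \<subseteq> D r n la}
    \<and> (\<forall>la \<in> Part r n. \<forall>S. S \<subseteq> D r n la \<longrightarrow>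
          noncrossing_Le_diagram la S
        \<and> Gr_closure r n (orbit_cell r n la S) = positroid_variety r n la S)"
proof -
  have cover: "\<exists>A T M. A \<in> subsets r n \<and> T \<subseteq> InvQ r n A \<and> M \<in> support_mats r n A T \<and> V = colspan r M"
    if "V \<in> QGr r n" for V
  proof -
    obtain A M where AM: "A \<in> subsets r n" "M \<in> NC_cell_mats r n A" "V = colspan r M"
      using \<open>V \<in> QGr r n\<close> unfolding QGr_eq[OF assms] by blast
    let ?T = "{(i, j) \<in> InvQ r n A. M i (pos A j) \<noteq> 0}"
    have "M \<in> support_mats r n A ?T" using AM(2) by (auto simp: support_mats_def)
    moreover have "?T \<subseteq> InvQ r n A" by blast
    ultimately show ?thesis using AM(1,3) by (intro exI conjI)
  qed
  have mem: "colspan r M \<in> QGr r n" if "A \<in> subsets r n" "M \<in> support_mats r n A T" for A T M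
    unfolding QGr_eq[OF assms] using that(1) support_matsD(1)[OF that(2,1)] by blast
  have D: "\<exists>A T. A \<in> subsets r n \<and> T \<subseteq> InvQ r n A \<and> la = partition_of A \<and> S = box_of n A ` T"
    if la: "la \<in> Part r n" and S: "S \<subseteq> D r n la" for la S
  proof -
    have A: "subset_of r n la \<in> subsets r n" "la = partition_of (subset_of r n la)"
      using subset_of_partition(2)[OF assms la] by auto
    obtain T where "T \<subseteq> InvQ r n (subset_of r n la)" "S = box_of n (subset_of r n la) ` T"
      using S unfolding D_def by (rule subset_imageE)
    then show ?thesis using A by (intro exI conjI)
  qed
  have stable: "torus_act t V \<in> QGr r n" if t: "t \<in> torus n" and V: "V \<in> QGr r n" for t V
  proof -
    obtain A T M where *: "A \<in> subsets r n" "M \<in> support_mats r n A T" "V = colspan r M"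
      using cover[OF V] by blast
    obtain N where "N \<in> support_mats r n A T" "torus_act t (colspan r M) = colspan r N"
      using torus_act_cell[OF *(1,2) t] by blast
    then show ?thesis using mem[OF *(1)] *(3) by simp
  qed
  have orbits: "{torus_orbit n V | V. V \<in> QGr r n}
      = {orbit_cell r n la S | la S. la \<in> Part r n \<and> S \<subseteq> D r n la}"
  proof (intro equalityI subsetI)
    fix X assume "X \<in> {torus_orbit n V | V. V \<in> QGr r n}"
    then obtain V where V: "V \<in> QGr r n" "X = torus_orbit n V" by blast
    obtain A T M where *: "A \<in> subsets r n" "T \<subseteq> InvQ r n A" "M \<in> support_mats r n A T" "V = colspan r M"
      using cover[OF V(1)] by blast
    have "X = orbit_cell r n (partition_of A) (box_of n A ` T)"
      unfolding V(2) *(4) torus_orbit_support[OF *(1,3)] orbit_cell_eq[OF *(1) assms *(2)] ..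
    moreover have "partition_of A \<in> Part r n" "box_of n A ` T \<subseteq> D r n (partition_of A)"
      using subset_of_partition(1)[OF assms *(1)] *(2) by (auto simp: D_def)
    ultimately show "X \<in> {orbit_cell r n la S | la S. la \<in> Part r n \<and> S \<subseteq> D r n la}" by blast
  next
    fix X assume "X \<in> {orbit_cell r n la S | la S. la \<in> Part r n \<and> S \<subseteq> D r n la}"
    then obtain la S where X: "X = orbit_cell r n la S" "la \<in> Part r n" "S \<subseteq> D r n la" by blast
    obtain A T where *: "A \<in> subsets r n" "T \<subseteq> InvQ r n A" "la = partition_of A" "S = box_of n A ` T"
      using D[OF X(2,3)] by blast
    obtain M where M: "M \<in> support_mats r n A T" using support_mats_nonempty[OF *(1,2)] by blast
    have "X = torus_orbit n (colspan r M)"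
      unfolding X(1) *(3,4) torus_orbit_support[OF *(1) M] orbit_cell_eq[OF *(1) assms *(2)] ..
    then show "X \<in> {torus_orbit n V | V. V \<in> QGr r n}" using mem[OF *(1) M] by blast
  qed
  have closures: "noncrossing_Le_diagram la S
      \<and> Gr_closure r n (orbit_cell r n la S) = positroid_variety r n la S"
    if la: "la \<in> Part r n" and S: "S \<subseteq> D r n la" for la S
  proof -
    obtain A T where *: "A \<in> subsets r n" "T \<subseteq> InvQ r n A" "la = partition_of A" "S = box_of n A ` T"
      using D[OF la S] by blast
    have "noncrossing_Le_diagram la S"
      unfolding *(3,4) using *(2) by (intro noncrossing_Le_diagram_subset[OF *(1)]) blast
    then show ?thesis
      unfolding *(3,4) positroid_variety_def orbit_cell_eq[OF *(1) assms *(2)]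
        positroid_cell_eq[OF *(1) assms *(2)] by simp
  qed
  show ?thesis
  proof (intro conjI ballI allI impI)
    show "torus_act t V \<in> QGr r n" if "t \<in> torus n" "V \<in> QGr r n" for t V
      using that by (rule stable)
    show "{torus_orbit n V | V. V \<in> QGr r n}
        = {orbit_cell r n la S | la S. la \<in> Part r n \<and> S \<subseteq> D r n la}"
      by (rule orbits)
    fix la S assume *: "la \<in> Part r n" "S \<subseteq> D r n la"
    show "noncrossing_Le_diagram la S" "Gr_closure r n (orbit_cell r n la S) = positroid_variety r n la S"
      using closures[OF *] by simp_all
  qed
qed

end
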